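(* Let $(\mathbf{x}^k)_{k\ge 1}$ be the sequence generated by Adam (as defined in the context). Assume: (i) $\mathbb{E}[\mathbf{g}^k\mid\mathcal{F}^k]=\nabla f(\mathbf{x}^k)$ for all $k\ge1$, and there exists $M>0$ such that $\|\mathbf{g}^k\|\le M$ almost surely for all $k\ge1$; (ii) $f$ is bounded below, with $f^*:=\inf_{\mathbf{x}\in\mathbb{R}^d} f(\mathbf{x})>-\infty$, and $f$ is $L$-smooth for some $L>0$, i.e. $\|\nabla f(\mathbf{x})-\nabla f(\mathbf{y})\|\le L\|\mathbf{x}-\mathbf{y}\|$ for all $\mathbf{x},\mathbf{y}\in\mathbb{R}^d$; (iii) $\sum_{k=1}^{\infty}\eta_k=\infty$, $\sum_{k=1}^{\infty}\eta_k^2<\infty$, $\sum_{k=1}^{\infty}\eta_k(1-\theta_k)<\infty$; (iv) there exist a non-increasing real sequence $(\alpha_k)_{k\ge1}$ and positive constants $C_0,\tilde C_0$ such that $C_0\alpha_k\le\eta_k\le\tilde C_0\alpha_k$ for all $k\ge1$; (v) (Polyak–Łojasiewicz condition) there exists $v>0$ such that $\|\nabla f(\mathbf{x})\|^2\ge 2v\,(f(\mathbf{x})-f^* )$ for all $\mathbf{x}\in\mathbb{R}^d$. Then $$\lim_{k\to\infty}f(\mathbf{x}^k)=f^*\ \text{ almost surely, and}\quad \lim_{k\to\infty}\mathbb{E}\big[f(\mathbf{x}^k)\big]=f^*.$$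
   Context: Setting: $f:\mathbb{R}^d\to\mathbb{R}$ is differentiable, $f(\mathbf{x})=\mathbb{E}_{\xi\sim\mathbb{P}}[\ell(\mathbf{x};\xi)]$. All vector operations (powers, square roots, products, quotients, adding a scalar) are element-wise; $\|\cdot\|$ is the Euclidean norm. Adam: given deterministic parameters $\eta_k>0$ (step size), $\epsilon>0$, $0\le\beta_k\le\beta<1$, $\theta_k\in(0,1)$ for $k\ge1$, initialize $\mathbf{m}^0=\mathbf{0}$, $\mathbf{v}^0=\mathbf{0}$, $\mathbf{x}^1\in\mathbb{R}^d$ (deterministic). For $k=1,2,\dots$: sample the stochastic gradient $\mathbf{g}^k=\nabla\ell(\mathbf{x}^k;\xi^k)$, where $\xi^k$ is the random data sample drawn at iteration $k$, and set $$\mathbf{m}^k=\beta_k\mathbf{m}^{k-1}+(1-\beta_k)\mathbf{g}^k,\quad \mathbf{v}^k=\theta_k\mathbf{v}^{k-1}+(1-\theta_k)(\mathbf{g}^k)^2,\quad \mathbf{x}^{k+1}=\mathbf{x}^k-\eta_k\frac{\mathbf{m}^k}{\sqrt{\mathbf{v}^k+\epsilon}}.$$ $\mathcal{F}^k:=\sigma(\mathbf{x}^1,\dots,\mathbf{x}^k)$. *)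

theory Defs
  imports "HOL-Probability.Probability"
begin

(* The sigma-algebra generated by x 1, ..., x k on the sample space of M.  Only its measurable
   sets matter: it is used as the second argument of a conditional expectation. *)
definition history :: "'w measure \<Rightarrow> (nat \<Rightarrow> 'w \<Rightarrow> 'a::topological_space) \<Rightarrow> nat \<Rightarrow> 'w measure" where
  "history M x k = sigma (space M) {x j -` B \<inter> space M | j B. j \<in> {1..k} \<and> B \<in> sets borel}"

(* The library offers conditional expectation only for real random variables; for random vectors
   it is taken coordinate by coordinate. *)
definition vec_cond_exp ::
  "'w measure \<Rightarrow> 'w measure \<Rightarrow> ('w \<Rightarrow> real ^ 'd) \<Rightarrow> 'w \<Rightarrow> real ^ 'd::finite" where
  "vec_cond_exp M F X = (\<lambda>\<omega>. \<chi> i. real_cond_exp M F (\<lambda>\<omega>'. X \<omega>' $ i) \<omega>)"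

(* One realization of Adam: \<xi> is the sequence of data samples, g the stochastic gradients, m and v
   the first and second moment estimates, x the iterates.  The entries g 0, x 0 and \<xi> 0 are unused. *)
definition adam ::
  "(nat \<Rightarrow> real) \<Rightarrow> real \<Rightarrow> (nat \<Rightarrow> real) \<Rightarrow> (nat \<Rightarrow> real) \<Rightarrow> real ^ 'd \<Rightarrow>
   (real ^ 'd \<Rightarrow> 's \<Rightarrow> real) \<Rightarrow> (nat \<Rightarrow> 's) \<Rightarrow>
   (nat \<Rightarrow> real ^ 'd) \<Rightarrow> (nat \<Rightarrow> real ^ 'd) \<Rightarrow> (nat \<Rightarrow> real ^ 'd) \<Rightarrow> (nat \<Rightarrow> real ^ 'd::finite) \<Rightarrow> bool"
where
  "adam \<eta> \<epsilon> \<beta> \<theta> x1 loss \<xi> g m v x \<longleftrightarrow>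
     m 0 = 0 \<and> v 0 = 0 \<and> x 1 = x1 \<and>
     (\<forall>k\<ge>1.
        GDERIV (\<lambda>y. loss y (\<xi> k)) (x k) :> g k \<and>
        m k = \<beta> k *\<^sub>R m (k - 1) + (1 - \<beta> k) *\<^sub>R g k \<and>
        v k = \<theta> k *\<^sub>R v (k - 1) + (1 - \<theta> k) *\<^sub>R (\<chi> i. (g k $ i)\<^sup>2) \<and>
        x (k + 1) = x k - \<eta> k *\<^sub>R (\<chi> i. m k $ i / sqrt (v k $ i + \<epsilon>)))"

end

theory Submission
  imports Defs
begin

text \<open>The iterates do not determine the moment estimates, so \<open>h\<^sup>n = sqrt (v\<^sup>n + \<epsilon>)\<close> need not be
  measurable with respect to the history \<open>F\<^sup>n\<^sup>+\<^sup>1\<close> of the iterates. Work coordinate by coordinate and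
  replace \<open>h\<^sup>n\<close> by its conditional expectation given that history. The normalized direction
  \<open>m\<^sup>n / h\<^sup>n\<close> is visible in the next iterate, so the error made by the replacement is controlled by the
  increments of the conditional expectations. By orthogonality and the slow drift of \<open>h\<close>, the squared
  increments telescope; weighted with the almost monotone step sizes they have a finite sum. The same bound
  handles the momentum recursion, and the descent inequality of the smooth function \<open>f\<close> then yields
  \<open>\<Sum>k. \<eta>\<^sub>k E |grad f (x\<^sup>k)|\<^sup>2 < \<infinity>\<close>. With the PL inequality, the gap \<open>\<Delta>\<^sub>k = f (x\<^sup>k) - f\<^sup>*\<close> satisfies
  \<open>\<Sum>k. \<eta>\<^sub>k \<Delta>\<^sub>k < \<infinity>\<close> almost surely and in mean. Since \<open>\<Delta>\<close> grows by at most a multiple of \<open>\<eta>\<^sub>k\<close> per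
  step and the step sizes are square summable but not summable, \<open>\<Delta>\<close> tends to zero in both senses.\<close>

section \<open>Deterministic weighted sequences\<close>

text \<open>The increments \<open>c * \<eta> n\<close> allowed for \<open>D\<close> need not have a
  finite sum, but the growth of the square of \<open>D\<close> carries the factor \<open>D n\<close>
  and is summable. So this square is a decreasing sequence bounded below plus a convergent series,
  and \<open>D\<close> has a limit. A positive limit would bound \<eta> eventually by a multiple of
  the summable \<open>\<eta> n * D n\<close>.\<close>

lemma tendsto_zero_of_weighted_summable:
  fixes \<eta> D :: "nat \<Rightarrow> real"
  assumes "\<And>n. 0 \<le> \<eta> n" "\<not> summable \<eta>" "summable (\<lambda>n. (\<eta> n)\<^sup>2)"
    and D: "\<And>n. 0 \<le> D n" "0 \<le> c" "\<And>n. D (Suc n) \<le> D n + c * \<eta> n"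
    and "summable (\<lambda>n. \<eta> n * D n)"
  shows "D \<longlonglongrightarrow> 0"
proof -
  \<comment> \<open>This is exactly the excess of \<open>(D n + c * \<eta> n)\<^sup>2\<close> over
    \<open>(D n)\<^sup>2\<close>.\<close>
  define s where "s n = 2 * c * (\<eta> n * D n) + c\<^sup>2 * (\<eta> n)\<^sup>2" for n
  have s: "summable s" unfolding s_def
    by (intro summable_add summable_mult assms)
  have s0: "0 \<le> s n" for n using assms D by (simp add: s_def)
  define E where "E n = (D n)\<^sup>2 - (\<Sum>k<n. s k)" for n
  have "decseq E"
  proof (rule decseq_SucI)
    fix n
    have "(D (Suc n))\<^sup>2 \<le> (D n + c * \<eta> n)\<^sup>2"
      by (intro power_mono D)
    also have "\<dots> = (D n)\<^sup>2 + s n"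
      by (simp add: s_def power2_eq_square algebra_simps)
    finally show "E (Suc n) \<le> E n" by (simp add: E_def)
  qed
  moreover have "- suminf s \<le> E n" for n
  proof -
    have "(\<Sum>k<n. s k) \<le> suminf s" by (rule sum_le_suminf[OF s]) (use s0 in auto)
    moreover have "0 \<le> (D n)\<^sup>2" by simp
    ultimately show ?thesis unfolding E_def by linarith
  qed
  ultimately obtain l where l: "E \<longlonglongrightarrow> l"
    using decseq_convergent by blast
  have "(\<lambda>n. E n + (\<Sum>k<n. s k)) \<longlonglongrightarrow> l + suminf s"
    by (intro tendsto_add l summable_LIMSEQ s)
  then have "(\<lambda>n. (D n)\<^sup>2) \<longlonglongrightarrow> l + suminf s" by (simp add: E_def)
  from tendsto_real_sqrt[OF this] have lim: "D \<longlonglongrightarrow> sqrt (l + suminf s)"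
    using D by simp
  have "sqrt (l + suminf s) = 0"
  proof (rule ccontr)
    assume ne: "sqrt (l + suminf s) \<noteq> 0"
    have "0 \<le> sqrt (l + suminf s)" using D by (intro LIMSEQ_le_const[OF lim]) auto
    with ne have pos: "0 < sqrt (l + suminf s)" by simp
    define r where "r = sqrt (l + suminf s) / 2"
    have r: "0 < r" "r < sqrt (l + suminf s)" using pos by (simp_all add: r_def)
    have "eventually (\<lambda>n. r < D n) sequentially"
      using order_tendstoD(1)[OF lim r(2)] .
    then have "eventually (\<lambda>n. norm (\<eta> n) \<le> (\<eta> n * D n) / r) sequentially"
    proof eventually_elim
      case (elim n)
      then have "\<eta> n * r \<le> \<eta> n * D n" using assms(1)[of n] by (intro mult_left_mono) auto
      then show ?case using r assms(1)[of n] by (simp add: field_simps)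
    qed
    then have "summable \<eta>"
      by (rule summable_comparison_test_ev) (intro summable_divide assms)
    then show False using assms by blast
  qed
  with lim show ?thesis by simp
qed

text \<open>As \<alpha> does not increase, \<open>\<alpha> (Suc n) * N (Suc n)\<close> is at most
  \<open>b * (\<alpha> n * (N n + R n))\<close>. Summing from \<open>N 0 = 0\<close> bounds the
  weighted sum of \<open>N\<close> by \<open>b\<close> times that of \<open>N + R\<close>;
  rearranging leaves the factor \<open>1 - b\<close>.\<close>

lemma weighted_sum_linear_recursion:
  fixes \<alpha> N R :: "nat \<Rightarrow> real"
  assumes "\<And>n. 0 \<le> \<alpha> n" "\<And>n. \<alpha> (Suc n) \<le> \<alpha> n" "\<And>n. 0 \<le> R n" "0 \<le> b"
    and "N 0 = 0" "\<And>n. N (Suc n) = b * (N n + R n)"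
  shows "(1 - b) * (\<Sum>n<K. \<alpha> n * (N n + R n)) \<le> (\<Sum>n<K. \<alpha> n * R n)"
proof -
  have N: "0 \<le> N n" for n by (induction n) (simp_all add: assms)
  have "(\<Sum>n<Suc K. \<alpha> n * N n) \<le> b * (\<Sum>n<K. \<alpha> n * (N n + R n))" for K
  proof (induction K)
    case (Suc K)
    have "\<alpha> (Suc K) * N (Suc K) \<le> \<alpha> K * N (Suc K)"
      by (intro mult_right_mono assms N)
    also have "\<dots> = b * (\<alpha> K * (N K + R K))" by (simp add: assms)
    finally have "\<alpha> (Suc K) * N (Suc K) \<le> b * (\<alpha> K * (N K + R K))" .
    with Suc show ?case by (simp add: algebra_simps)
  qed (simp add: assms)
  from this[of K] have "(\<Sum>n<K. \<alpha> n * N n) \<le> b * (\<Sum>n<K. \<alpha> n * (N n + R n))"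
    using mult_nonneg_nonneg[OF assms(1) N, of K K] by simp
  then show ?thesis by (simp add: algebra_simps sum.distrib)
qed

text \<open>Summation by parts: under non-increasing weights, a sequence confined to the range from
  0 to \<open>Q\<close> gains no more than one full climb at the initial weight.\<close>

lemma weighted_sum_increments_le:
  fixes \<alpha> q :: "nat \<Rightarrow> real"
  assumes "\<And>n. 0 \<le> \<alpha> n" "\<And>n. \<alpha> (Suc n) \<le> \<alpha> n" "\<And>n. 0 \<le> q n" "\<And>n. q n \<le> Q"
  shows "(\<Sum>n<K. \<alpha> n * (q (Suc n) - q n)) \<le> \<alpha> 0 * Q"
proof -
  \<comment> \<open>The subtracted remainder closes the induction: it pays for the next increment
    and can only shrink when the weight drops.\<close>
  have "(\<Sum>n<K. \<alpha> n * (q (Suc n) - q n)) \<le> \<alpha> 0 * Q - \<alpha> K * (Q - q K)"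
  proof (induction K)
    case 0 then show ?case using mult_nonneg_nonneg[OF assms(1,3), of 0 0] by (simp add: algebra_simps)
  next
    case (Suc K)
    have "\<alpha> (Suc K) * (Q - q (Suc K)) \<le> \<alpha> K * (Q - q (Suc K))"
      using assms by (intro mult_right_mono) auto
    with Suc show ?case by (simp add: algebra_simps)
  qed
  moreover have "0 \<le> \<alpha> K * (Q - q K)" using assms by auto
  ultimately show ?thesis by linarith
qed

section \<open>Essentially bounded random variables\<close>

text \<open>Unlike integrability, this property survives products, so the integrability of all
  expressions below reduces to closure rules.\<close>

definition bounded_rv :: "'w measure \<Rightarrow> ('w \<Rightarrow> real) \<Rightarrow> bool" where
  "bounded_rv M X \<longleftrightarrow> X \<in> borel_measurable M \<and> (\<exists>c. AE \<omega> in M. \<bar>X \<omega>\<bar> \<le> c)"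

lemma bounded_rvI: "X \<in> borel_measurable M \<Longrightarrow> AE \<omega> in M. \<bar>X \<omega>\<bar> \<le> c \<Longrightarrow> bounded_rv M X"
  unfolding bounded_rv_def by blast

lemma bounded_rv_measurable: "bounded_rv M X \<Longrightarrow> X \<in> borel_measurable M"
  unfolding bounded_rv_def by blast

lemma bounded_rv_const: "bounded_rv M (\<lambda>_. c)"
  by (rule bounded_rvI[where c = "\<bar>c\<bar>"]) auto

lemma bounded_rv_add:
  assumes "bounded_rv M X" "bounded_rv M Y"
  shows "bounded_rv M (\<lambda>\<omega>. X \<omega> + Y \<omega>)"
proof -
  obtain c d where "AE \<omega> in M. \<bar>X \<omega>\<bar> \<le> c" "AE \<omega> in M. \<bar>Y \<omega>\<bar> \<le> d"
    using assms unfolding bounded_rv_def by blast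
  then have "AE \<omega> in M. \<bar>X \<omega> + Y \<omega>\<bar> \<le> c + d" by eventually_elim linarith
  then show ?thesis using assms[THEN bounded_rv_measurable] by (intro bounded_rvI) auto
qed

lemma bounded_rv_mult:
  assumes "bounded_rv M X" "bounded_rv M Y"
  shows "bounded_rv M (\<lambda>\<omega>. X \<omega> * Y \<omega>)"
proof -
  obtain c d where "AE \<omega> in M. \<bar>X \<omega>\<bar> \<le> c" "AE \<omega> in M. \<bar>Y \<omega>\<bar> \<le> d"
    using assms unfolding bounded_rv_def by blast
  then have "AE \<omega> in M. \<bar>X \<omega> * Y \<omega>\<bar> \<le> c * d"
    by eventually_elim (auto simp: abs_mult intro!: mult_mono)
  then show ?thesis using assms[THEN bounded_rv_measurable] by (intro bounded_rvI) auto
qed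

lemma bounded_rv_diff:
  assumes "bounded_rv M X" "bounded_rv M Y"
  shows "bounded_rv M (\<lambda>\<omega>. X \<omega> - Y \<omega>)"
  using bounded_rv_add[OF assms(1) bounded_rv_mult[OF bounded_rv_const[of M "-1"] assms(2)]] by simp

lemma bounded_rv_power: "bounded_rv M X \<Longrightarrow> bounded_rv M (\<lambda>\<omega>. X \<omega> ^ n)"
  by (induction n) (auto intro: bounded_rv_const bounded_rv_mult)

lemma bounded_rv_sum:
  "(\<And>i. i \<in> I \<Longrightarrow> bounded_rv M (X i)) \<Longrightarrow> bounded_rv M (\<lambda>\<omega>. \<Sum>i\<in>I. X i \<omega>)"
  by (induction I rule: infinite_finite_induct) (auto intro: bounded_rv_const bounded_rv_add)

lemmas bounded_rv_intros = bounded_rv_const bounded_rv_add bounded_rv_mult bounded_rv_diff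
  bounded_rv_power bounded_rv_sum

lemma (in finite_measure) bounded_rv_integrable: "bounded_rv M X \<Longrightarrow> integrable M X"
  unfolding bounded_rv_def by (elim conjE exE, rule integrable_const_bound) simp_all

section \<open>The momentum recursion in one coordinate\<close>

text \<open>Follows by completing a square. A small \<delta> lets the gradient part be absorbed by
  the main term, while the part with the increment goes into a convergent series.\<close>

lemma Young_quadratic:
  fixes \<delta> :: real
  assumes "0 < \<delta>"
  shows "\<kappa> * \<bar>a\<bar> * \<bar>d\<bar> \<le> \<delta> * a\<^sup>2 + \<kappa>\<^sup>2 / \<delta> * d\<^sup>2"
proof -
  have "0 \<le> (\<delta> * \<bar>a\<bar> - \<kappa> * \<bar>d\<bar>)\<^sup>2 + \<delta>\<^sup>2 * a\<^sup>2 + \<kappa>\<^sup>2 * d\<^sup>2" by simp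
  also have "\<dots> = 2 * \<delta> * (\<delta> * a\<^sup>2 + \<kappa>\<^sup>2 / \<delta> * d\<^sup>2 - \<kappa> * \<bar>a\<bar> * \<bar>d\<bar>)"
    using assms by (simp add: power2_diff power_mult_distrib field_simps power2_eq_square[of \<delta>])
  finally show ?thesis using assms by (simp add: zero_le_mult_iff)
qed

text \<open>Index \<open>n\<close> stands for iteration \<open>n + 1\<close> of Adam in \<open>F\<close>, \<open>a\<close>, \<open>g\<close>, \<open>u\<close>, \<open>\<alpha>\<close>, \<open>\<beta>\<close>, \<open>\<eta>\<close>, whereas \<open>m n\<close>
  and \<open>h n\<close> belong to the moment estimates known before that iteration.\<close>

locale momentum_coordinate = prob_space M for M :: "'w measure" +
  fixes F :: "nat \<Rightarrow> 'w measure" and a g u m h :: "nat \<Rightarrow> 'w \<Rightarrow> real"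
    and \<alpha> \<beta> \<eta> s :: "nat \<Rightarrow> real" and b B D h0 H C0 C0' :: real
  assumes subalgebras: "\<And>n. subalgebra M (F n)" "\<And>n. subalgebra (F (Suc n)) (F n)"
    and adapted: "\<And>n. a n \<in> borel_measurable (F n)" "\<And>n. u n \<in> borel_measurable (F (Suc n))"
    and measurable: "\<And>n. g n \<in> borel_measurable M" "\<And>n. m n \<in> borel_measurable M"
      "\<And>n. h n \<in> borel_measurable M"
    and unbiased: "\<And>n. AE \<omega> in M. real_cond_exp M (F n) (g n) \<omega> = a n \<omega>"
    and bounds: "\<And>n. AE \<omega> in M. \<bar>a n \<omega>\<bar> \<le> B" "\<And>n. AE \<omega> in M. \<bar>g n \<omega>\<bar> \<le> B"
      "\<And>n. AE \<omega> in M. \<bar>m n \<omega>\<bar> \<le> B"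
      "\<And>n. AE \<omega> in M. h0 \<le> h n \<omega>" "\<And>n. AE \<omega> in M. h n \<omega> \<le> H" "0 \<le> B" "0 < h0" "0 \<le> D"
    and slow: "\<And>n. AE \<omega> in M. \<bar>h (Suc n) \<omega> - h n \<omega>\<bar> \<le> s n"
      "\<And>n. AE \<omega> in M. \<bar>a (Suc n) \<omega> - a n \<omega>\<bar> \<le> D * \<eta> n"
    and momentum: "\<And>\<omega>. \<omega> \<in> space M \<Longrightarrow> m 0 \<omega> = 0"
      "\<And>n \<omega>. \<omega> \<in> space M \<Longrightarrow> m (Suc n) \<omega> = \<beta> n * m n \<omega> + (1 - \<beta> n) * g n \<omega>"
      "\<And>n \<omega>. \<omega> \<in> space M \<Longrightarrow> u n \<omega> = m (Suc n) \<omega> / h (Suc n) \<omega>"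
      "\<And>n. 0 \<le> \<beta> n" "\<And>n. \<beta> n \<le> b" "b < 1"
    and steps: "\<And>n. 0 \<le> \<alpha> n" "\<And>n. \<alpha> (Suc n) \<le> \<alpha> n" "0 < C0" "0 < C0'"
      "\<And>n. C0 * \<alpha> n \<le> \<eta> n" "\<And>n. \<eta> n \<le> C0' * \<alpha> n"
      "summable (\<lambda>n. (\<eta> n)\<^sup>2)" "summable (\<lambda>n. \<eta> n * s n)"
begin

lemma sigma_finite_F: "sigma_finite_subalgebra M (F n)"
proof -
  interpret finite_measure_subalgebra M "F n"
    by unfold_locales (rule subalgebras)
  show ?thesis ..
qed

lemma F_measurable: "X \<in> borel_measurable (F n) \<Longrightarrow> X \<in> borel_measurable M"
  using measurable_from_subalg[OF subalgebras(1)] .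

lemma F_Suc_measurable: "X \<in> borel_measurable (F n) \<Longrightarrow> X \<in> borel_measurable (F (Suc n))"
  using measurable_from_subalg[OF subalgebras(2)] .

text \<open>The scaling \<open>h n\<close> need not be \<open>F n\<close>-measurable, since the iterates do not determine the
  moment estimates; \<open>hp n\<close> is its best \<open>F n\<close>-measurable prediction.\<close>

definition hp :: "nat \<Rightarrow> 'w \<Rightarrow> real" where "hp n = real_cond_exp M (F n) (h n)"

text \<open>Being \<open>F n\<close>-measurable, this reciprocal can multiply \<open>g n\<close>
  without disturbing its conditional mean, which \<open>1 / h n\<close> might do.\<close>

definition Z :: "nat \<Rightarrow> 'w \<Rightarrow> real" where "Z n \<omega> = 1 / hp n \<omega>"

lemma hp_measurable [measurable]: "hp n \<in> borel_measurable (F n)"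
  unfolding hp_def by simp

lemma Z_measurable [measurable]: "Z n \<in> borel_measurable (F n)"
  unfolding Z_def by measurable

lemma h0_le_H: "h0 \<le> H"
proof -
  have "AE \<omega> in M. h0 \<le> H" using bounds(4,5)[of 0] by eventually_elim simp
  then show ?thesis by simp
qed

lemma H_pos: "0 < H" using h0_le_H bounds by simp

lemma bounded_h: "bounded_rv M (h n)"
proof (rule bounded_rvI[OF measurable(3), where c = H])
  show "AE \<omega> in M. \<bar>h n \<omega>\<bar> \<le> H"
    using bounds(4,5)[of n] by eventually_elim (use bounds(7) in simp)
qed

lemma hp_bounds: "AE \<omega> in M. h0 \<le> hp n \<omega>" "AE \<omega> in M. hp n \<omega> \<le> H"
  using bounded_h[THEN bounded_rv_integrable] bounds(4,5)[of n]
    sigma_finite_subalgebra.real_cond_exp_ge_c[OF sigma_finite_F]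
    sigma_finite_subalgebra.real_cond_exp_le_c[OF sigma_finite_F]
  unfolding hp_def by blast+

lemma Z_bounds: "AE \<omega> in M. 1 / H \<le> Z n \<omega>" "AE \<omega> in M. \<bar>Z n \<omega>\<bar> \<le> 1 / h0"
proof -
  show "AE \<omega> in M. 1 / H \<le> Z n \<omega>"
    using hp_bounds[of n] by eventually_elim (use bounds(7) in \<open>auto simp: Z_def intro!: divide_left_mono\<close>)
  show "AE \<omega> in M. \<bar>Z n \<omega>\<bar> \<le> 1 / h0"
    using hp_bounds[of n] by eventually_elim (use bounds(7) in \<open>auto simp: Z_def intro!: divide_left_mono\<close>)
qed

lemma u_bound: "AE \<omega> in M. \<bar>u n \<omega>\<bar> \<le> B / h0"
  using bounds(3)[of "Suc n"] bounds(4)[of "Suc n"] AE_space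
proof eventually_elim
  case (elim \<omega>)
  have "\<bar>m (Suc n) \<omega>\<bar> / h (Suc n) \<omega> \<le> B / h0"
    using elim bounds by (intro frac_le) auto
  then show ?case using elim bounds(7) by (simp add: momentum)
qed

lemma bounded_hp: "bounded_rv M (hp n)"
proof (rule bounded_rvI[OF F_measurable[OF hp_measurable], where c = H])
  show "AE \<omega> in M. \<bar>hp n \<omega>\<bar> \<le> H"
    using hp_bounds[of n] by eventually_elim (use bounds(7) in simp)
qed

lemma bounded_Z: "bounded_rv M (Z n)"
  by (rule bounded_rvI[OF F_measurable[OF Z_measurable] Z_bounds(2)])

lemma bounded_a: "bounded_rv M (a n)"
  by (rule bounded_rvI[OF F_measurable[OF adapted(1)] bounds(1)])

lemma bounded_u: "bounded_rv M (u n)"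
  by (rule bounded_rvI[OF F_measurable[OF adapted(2)] u_bound])

lemma bounded_g: "bounded_rv M (g n)"
  by (rule bounded_rvI[OF measurable(1) bounds(2)])

lemma bounded_m: "bounded_rv M (m n)"
  by (rule bounded_rvI[OF measurable(2) bounds(3)])

lemmas bounded_intros = bounded_rv_intros bounded_a bounded_u bounded_g bounded_m bounded_h
  bounded_hp bounded_Z
lemmas integrable_intros = bounded_rv_integrable bounded_intros

text \<open>The defining property of conditional expectation. Through it \<open>h\<close> and its
  prediction are exchanged against factors that the history already determines.\<close>

lemma expectation_mult_hp:
  assumes "X \<in> borel_measurable (F n)" "bounded_rv M X"
  shows "expectation (\<lambda>\<omega>. X \<omega> * hp n \<omega>) = expectation (\<lambda>\<omega>. X \<omega> * h n \<omega>)"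
  unfolding hp_def
  by (rule sigma_finite_subalgebra.real_cond_exp_intg(2)[OF sigma_finite_F])
    (use assms measurable in \<open>auto intro!: integrable_intros\<close>)

section \<open>Squared increments of the prediction\<close>

definition q :: "nat \<Rightarrow> real" where "q n = expectation (\<lambda>\<omega>. (hp n \<omega>)\<^sup>2)"
definition Q :: "nat \<Rightarrow> real" where "Q n = expectation (\<lambda>\<omega>. (hp (Suc n) \<omega> - hp n \<omega>)\<^sup>2)"

lemma Q_nonneg: "0 \<le> Q n" unfolding Q_def by simp

lemma s_nonneg: "0 \<le> s n"
proof -
  have "AE \<omega> in M. 0 \<le> s n" using slow(1)[of n] by eventually_elim simp
  then show ?thesis by simp
qed

lemma q_bounds: "0 \<le> q n" "q n \<le> H\<^sup>2"
proof -
  show "0 \<le> q n" unfolding q_def by simp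
  have "q n \<le> expectation (\<lambda>_. H\<^sup>2)"
    unfolding q_def
  proof (rule integral_mono_AE)
    show "AE \<omega> in M. (hp n \<omega>)\<^sup>2 \<le> H\<^sup>2"
      using hp_bounds[of n] by eventually_elim (use bounds(7) in \<open>auto intro!: power_mono\<close>)
  qed (auto intro!: integrable_intros)
  then show "q n \<le> H\<^sup>2" by (simp add: prob_space)
qed

text \<open>Predictions of a fixed variable along a filtration have orthogonal increments, so up to the
  drift of \<open>h\<close> the squared increments of \<open>hp\<close> telescope.\<close>

lemma Q_le: "Q n \<le> q (Suc n) - q n + 2 * H * s n"
proof -
  have "Q n = expectation (\<lambda>\<omega>. (hp (Suc n) \<omega>)\<^sup>2 + (hp n \<omega>)\<^sup>2 - 2 * (hp n \<omega> * hp (Suc n) \<omega>))"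
    unfolding Q_def by (simp add: power2_diff mult_ac)
  also have "\<dots> = q (Suc n) + q n - 2 * expectation (\<lambda>\<omega>. hp n \<omega> * hp (Suc n) \<omega>)"
    unfolding q_def by (simp add: integrable_intros)
  also have "expectation (\<lambda>\<omega>. hp n \<omega> * hp (Suc n) \<omega>) = expectation (\<lambda>\<omega>. hp n \<omega> * h (Suc n) \<omega>)"
    by (intro expectation_mult_hp F_Suc_measurable hp_measurable bounded_hp)
  finally have 1: "Q n = q (Suc n) + q n - 2 * expectation (\<lambda>\<omega>. hp n \<omega> * h (Suc n) \<omega>)" .
  \<comment> \<open>Since \<open>q n\<close> is the mean of \<open>hp n * h n\<close>, passing from
    \<open>h n\<close> to \<open>h (Suc n)\<close> costs at most \<open>H * s n\<close>, as
    \<open>hp n\<close> lies between 0 and \<open>H\<close> almost surely.\<close>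
  have "q n - H * s n = expectation (\<lambda>\<omega>. hp n \<omega> * h n \<omega>) - H * s n"
    using expectation_mult_hp[OF hp_measurable bounded_hp, of n] by (simp add: q_def power2_eq_square)
  also have "\<dots> = expectation (\<lambda>\<omega>. hp n \<omega> * h n \<omega> - H * s n)"
    by (simp add: integrable_intros prob_space)
  also have "\<dots> \<le> expectation (\<lambda>\<omega>. hp n \<omega> * h (Suc n) \<omega>)"
  proof (rule integral_mono_AE)
    show "AE \<omega> in M. hp n \<omega> * h n \<omega> - H * s n \<le> hp n \<omega> * h (Suc n) \<omega>"
      using hp_bounds[of n] slow(1)[of n]
    proof eventually_elim
      case (elim \<omega>)
      have "hp n \<omega> * (h n \<omega> - h (Suc n) \<omega>) \<le> hp n \<omega> * s n"
        using elim bounds(7) by (intro mult_left_mono) auto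
      also have "\<dots> \<le> H * s n"
        using elim s_nonneg by (intro mult_right_mono) auto
      finally have "hp n \<omega> * (h n \<omega> - h (Suc n) \<omega>) \<le> H * s n" .
      then show ?case by (simp add: algebra_simps)
    qed
  qed (auto intro!: integrable_intros)
  finally show ?thesis using 1 by simp
qed

section \<open>Correlation of the gradient with the step direction\<close>

text \<open>Common bound for the two coefficients met below: the product of \<open>u n\<close> and
  \<open>Z n\<close>, and \<open>m (Suc n)\<close> divided by two consecutive predictions.\<close>

definition \<kappa> :: real where "\<kappa> = B / h0\<^sup>2"

definition E2 :: "nat \<Rightarrow> real" where "E2 n = expectation (\<lambda>\<omega>. (a n \<omega>)\<^sup>2)"
text \<open>Surrogate for the mean of \<open>a n * u n\<close>: the true scaling
  \<open>h (Suc n)\<close> inside \<open>u n\<close> is replaced by \<open>hp n\<close>, which is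
  known before the gradient is drawn.\<close>

definition A :: "nat \<Rightarrow> real" where "A n = expectation (\<lambda>\<omega>. a n \<omega> * m (Suc n) \<omega> * Z n \<omega>)"

lemma E2_nonneg: "0 \<le> E2 n" unfolding E2_def by simp

lemma expectation_Young:
  assumes "0 < \<delta>" "bounded_rv M X"
    and "AE \<omega> in M. X \<omega> \<le> \<kappa> * \<bar>a n \<omega>\<bar> * \<bar>hp (Suc n) \<omega> - hp n \<omega>\<bar>"
  shows "expectation X \<le> \<delta> * E2 n + \<kappa>\<^sup>2 / \<delta> * Q n"
proof -
  have "expectation X \<le> expectation (\<lambda>\<omega>. \<delta> * (a n \<omega>)\<^sup>2 + \<kappa>\<^sup>2 / \<delta> * (hp (Suc n) \<omega> - hp n \<omega>)\<^sup>2)"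
  proof (rule integral_mono_AE)
    show "AE \<omega> in M. X \<omega> \<le> \<delta> * (a n \<omega>)\<^sup>2 + \<kappa>\<^sup>2 / \<delta> * (hp (Suc n) \<omega> - hp n \<omega>)\<^sup>2"
      using assms(3) by eventually_elim (rule order_trans[OF _ Young_quadratic[OF assms(1)]])
  qed (intro integrable_intros assms)+
  also have "\<dots> = \<delta> * E2 n + \<kappa>\<^sup>2 / \<delta> * Q n"
    unfolding E2_def Q_def by (subst Bochner_Integration.integral_add) (intro integrable_intros | simp)+
  finally show ?thesis .
qed

text \<open>Write \<open>m (Suc n)\<close> as \<open>u n * h (Suc n)\<close>. The direction
  \<open>u n\<close> is visible in the next iterate, so the factor \<open>a n * u n * Z n\<close> is
  \<open>F (Suc n)\<close>-measurable and \<open>h (Suc n)\<close> may be replaced by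
  \<open>hp (Suc n)\<close>. On the other side \<open>a n * u n\<close> equals the same factor times
  \<open>hp n\<close>. Only the increment of the prediction remains.\<close>

lemma A_minus_expectation_au:
  assumes "0 < \<delta>"
  shows "A n - expectation (\<lambda>\<omega>. a n \<omega> * u n \<omega>) \<le> \<delta> * E2 n + \<kappa>\<^sup>2 / \<delta> * Q n"
proof -
  let ?X = "\<lambda>\<omega>. a n \<omega> * u n \<omega> * Z n \<omega>"
  have meas: "?X \<in> borel_measurable (F (Suc n))"
    by (intro borel_measurable_times adapted F_Suc_measurable Z_measurable)
  have "A n = expectation (\<lambda>\<omega>. ?X \<omega> * h (Suc n) \<omega>)"
    unfolding A_def
  proof (rule integral_cong_AE)
    show "AE \<omega> in M. a n \<omega> * m (Suc n) \<omega> * Z n \<omega> = ?X \<omega> * h (Suc n) \<omega>"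
      using bounds(4)[of "Suc n"] AE_space
      by eventually_elim (use bounds(7) in \<open>simp add: momentum(3)\<close>)
  qed (intro bounded_rv_measurable bounded_intros)+
  also have "\<dots> = expectation (\<lambda>\<omega>. ?X \<omega> * hp (Suc n) \<omega>)"
    by (intro expectation_mult_hp[symmetric] meas bounded_intros)
  finally have 1: "A n = expectation (\<lambda>\<omega>. ?X \<omega> * hp (Suc n) \<omega>)" .
  have 2: "expectation (\<lambda>\<omega>. a n \<omega> * u n \<omega>) = expectation (\<lambda>\<omega>. ?X \<omega> * hp n \<omega>)"
  proof (rule integral_cong_AE)
    show "AE \<omega> in M. a n \<omega> * u n \<omega> = ?X \<omega> * hp n \<omega>"
      using hp_bounds(1)[of n]
      by eventually_elim (use bounds(7) in \<open>simp add: Z_def\<close>)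
  qed (intro bounded_rv_measurable bounded_intros)+
  have "A n - expectation (\<lambda>\<omega>. a n \<omega> * u n \<omega>)
      = expectation (\<lambda>\<omega>. ?X \<omega> * hp (Suc n) \<omega> - ?X \<omega> * hp n \<omega>)"
    unfolding 1 2 by (rule Bochner_Integration.integral_diff[symmetric]) (intro integrable_intros)+
  also have "\<dots> \<le> \<delta> * E2 n + \<kappa>\<^sup>2 / \<delta> * Q n"
  proof (rule expectation_Young[OF assms])
    show "AE \<omega> in M. ?X \<omega> * hp (Suc n) \<omega> - ?X \<omega> * hp n \<omega>
        \<le> \<kappa> * \<bar>a n \<omega>\<bar> * \<bar>hp (Suc n) \<omega> - hp n \<omega>\<bar>"
      using u_bound[of n] Z_bounds(2)[of n]
    proof eventually_elim
      case (elim \<omega>)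
      have "\<bar>u n \<omega>\<bar> * \<bar>Z n \<omega>\<bar> \<le> B / h0 * (1 / h0)"
        using elim by (intro mult_mono) auto
      also have "\<dots> = \<kappa>" by (simp add: \<kappa>_def power2_eq_square)
      finally have "(\<bar>u n \<omega>\<bar> * \<bar>Z n \<omega>\<bar>) * (\<bar>a n \<omega>\<bar> * \<bar>hp (Suc n) \<omega> - hp n \<omega>\<bar>)
          \<le> \<kappa> * (\<bar>a n \<omega>\<bar> * \<bar>hp (Suc n) \<omega> - hp n \<omega>\<bar>)"
        by (rule mult_right_mono) simp
      moreover have "?X \<omega> * hp (Suc n) \<omega> - ?X \<omega> * hp n \<omega> \<le> \<bar>?X \<omega> * (hp (Suc n) \<omega> - hp n \<omega>)\<bar>"
        by (simp add: right_diff_distrib)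
      ultimately show ?case by (simp add: abs_mult mult_ac)
    qed
  qed (intro bounded_intros)
  finally show ?thesis .
qed

text \<open>The momentum is kept fixed while gradient and scaling advance by one iteration. The
  change of \<open>a\<close> is of order \<open>\<eta> n\<close>; the change of the reciprocal
  \<open>Z\<close> is the increment of \<open>hp\<close> over a product of two predictions, and is
  treated by \<open>expectation_Young\<close>.\<close>

lemma A_drift:
  assumes "0 < \<delta>"
  shows "A n - expectation (\<lambda>\<omega>. a (Suc n) \<omega> * m (Suc n) \<omega> * Z (Suc n) \<omega>)
    \<le> D * B / h0 * \<eta> n + (\<delta> * E2 n + \<kappa>\<^sup>2 / \<delta> * Q n)"
proof -
  let ?X = "\<lambda>\<omega>. (a n \<omega> - a (Suc n) \<omega>) * m (Suc n) \<omega> * Z (Suc n) \<omega>"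
  let ?Y = "\<lambda>\<omega>. a n \<omega> * m (Suc n) \<omega> * (Z n \<omega> - Z (Suc n) \<omega>)"
  have "A n - expectation (\<lambda>\<omega>. a (Suc n) \<omega> * m (Suc n) \<omega> * Z (Suc n) \<omega>) =
      expectation (\<lambda>\<omega>. a n \<omega> * m (Suc n) \<omega> * Z n \<omega> - a (Suc n) \<omega> * m (Suc n) \<omega> * Z (Suc n) \<omega>)"
    unfolding A_def by (rule Bochner_Integration.integral_diff[symmetric]) (intro integrable_intros)+
  also have "\<dots> = expectation (\<lambda>\<omega>. ?X \<omega> + ?Y \<omega>)"
    by (simp add: algebra_simps)
  also have "\<dots> = expectation ?X + expectation ?Y"
    by (rule Bochner_Integration.integral_add) (intro integrable_intros)+
  also have "expectation ?X \<le> expectation (\<lambda>_. D * B / h0 * \<eta> n)"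
  proof (rule integral_mono_AE)
    show "AE \<omega> in M. ?X \<omega> \<le> D * B / h0 * \<eta> n"
      using slow(2)[of n] bounds(3)[of "Suc n"] Z_bounds(2)[of "Suc n"]
    proof eventually_elim
      case (elim \<omega>)
      have "\<bar>a n \<omega> - a (Suc n) \<omega>\<bar> * \<bar>m (Suc n) \<omega>\<bar> * \<bar>Z (Suc n) \<omega>\<bar> \<le> D * \<eta> n * B * (1 / h0)"
        using elim bounds(6) by (intro mult_mono) auto
      then show ?case using abs_ge_self[of "?X \<omega>"] by (simp add: abs_mult mult_ac)
    qed
  qed (intro integrable_intros)+
  also have "expectation ?Y \<le> \<delta> * E2 n + \<kappa>\<^sup>2 / \<delta> * Q n"
  proof (rule expectation_Young[OF assms])
    show "AE \<omega> in M. ?Y \<omega> \<le> \<kappa> * \<bar>a n \<omega>\<bar> * \<bar>hp (Suc n) \<omega> - hp n \<omega>\<bar>"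
      using bounds(3)[of "Suc n"] hp_bounds(1)[of n] hp_bounds(1)[of "Suc n"]
    proof eventually_elim
      case (elim \<omega>)
      have pos: "0 < hp n \<omega>" "0 < hp (Suc n) \<omega>" using elim bounds(7) by auto
      have "\<bar>m (Suc n) \<omega>\<bar> / (hp n \<omega> * hp (Suc n) \<omega>) \<le> B / (h0 * h0)"
        using elim bounds by (intro frac_le mult_mono) auto
      then have "\<bar>m (Suc n) \<omega>\<bar> / (hp n \<omega> * hp (Suc n) \<omega>) \<le> \<kappa>"
        by (simp add: \<kappa>_def power2_eq_square)
      then have "\<bar>m (Suc n) \<omega>\<bar> / (hp n \<omega> * hp (Suc n) \<omega>) * (\<bar>a n \<omega>\<bar> * \<bar>hp (Suc n) \<omega> - hp n \<omega>\<bar>)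
          \<le> \<kappa> * (\<bar>a n \<omega>\<bar> * \<bar>hp (Suc n) \<omega> - hp n \<omega>\<bar>)"
        by (rule mult_right_mono) simp
      moreover have "Z n \<omega> - Z (Suc n) \<omega> = (hp (Suc n) \<omega> - hp n \<omega>) / (hp n \<omega> * hp (Suc n) \<omega>)"
        using pos by (simp add: Z_def field_simps)
      then have "\<bar>?Y \<omega>\<bar> = \<bar>m (Suc n) \<omega>\<bar> / (hp n \<omega> * hp (Suc n) \<omega>) * (\<bar>a n \<omega>\<bar> * \<bar>hp (Suc n) \<omega> - hp n \<omega>\<bar>)"
        using pos by (simp add: abs_mult)
      ultimately show ?case using abs_ge_self[of "?Y \<omega>"] by linarith
    qed
  qed (intro bounded_intros)
  finally show ?thesis by (simp add: prob_space)
qed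

text \<open>Split \<open>m (Suc n)\<close> by its recursion. As \<open>a n * Z n\<close> is
  \<open>F n\<close>-measurable, unbiasedness turns the fresh gradient \<open>g n\<close> into
  \<open>a n\<close>, and \<open>Z n\<close> is at least \<open>1 / H\<close>.\<close>

lemma A_momentum: "A n \<ge> \<beta> n * expectation (\<lambda>\<omega>. a n \<omega> * m n \<omega> * Z n \<omega>) + (1 - b) / H * E2 n"
proof -
  have "A n = expectation (\<lambda>\<omega>. \<beta> n * (a n \<omega> * m n \<omega> * Z n \<omega>) + (1 - \<beta> n) * ((a n \<omega> * Z n \<omega>) * g n \<omega>))"
    unfolding A_def by (rule Bochner_Integration.integral_cong) (auto simp: momentum(2) algebra_simps)
  also have "\<dots> = \<beta> n * expectation (\<lambda>\<omega>. a n \<omega> * m n \<omega> * Z n \<omega>)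
      + (1 - \<beta> n) * expectation (\<lambda>\<omega>. (a n \<omega> * Z n \<omega>) * g n \<omega>)"
    by (subst Bochner_Integration.integral_add) (auto intro!: integrable_intros)
  also have "expectation (\<lambda>\<omega>. (a n \<omega> * Z n \<omega>) * g n \<omega>)
      = expectation (\<lambda>\<omega>. (a n \<omega> * Z n \<omega>) * real_cond_exp M (F n) (g n) \<omega>)"
    by (rule sigma_finite_subalgebra.real_cond_exp_intg(2)[OF sigma_finite_F, symmetric])
      (intro integrable_intros borel_measurable_times adapted Z_measurable measurable)+
  also have "\<dots> = expectation (\<lambda>\<omega>. (a n \<omega> * Z n \<omega>) * a n \<omega>)"
  proof (rule integral_cong_AE)
    show "AE \<omega> in M. a n \<omega> * Z n \<omega> * real_cond_exp M (F n) (g n) \<omega> = a n \<omega> * Z n \<omega> * a n \<omega>"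
      using unbiased[of n] by eventually_elim simp
  qed (intro borel_measurable_times borel_measurable_cond_exp2 bounded_rv_measurable bounded_intros)+
  finally have 1: "A n = \<beta> n * expectation (\<lambda>\<omega>. a n \<omega> * m n \<omega> * Z n \<omega>)
      + (1 - \<beta> n) * expectation (\<lambda>\<omega>. (a n \<omega> * Z n \<omega>) * a n \<omega>)" .
  have "1 / H * E2 n = expectation (\<lambda>\<omega>. 1 / H * (a n \<omega>)\<^sup>2)"
    unfolding E2_def by simp
  also have "\<dots> \<le> expectation (\<lambda>\<omega>. (a n \<omega> * Z n \<omega>) * a n \<omega>)"
  proof (rule integral_mono_AE)
    show "AE \<omega> in M. 1 / H * (a n \<omega>)\<^sup>2 \<le> a n \<omega> * Z n \<omega> * a n \<omega>"
      using Z_bounds(1)[of n]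
    proof eventually_elim
      case (elim \<omega>)
      then have "1 / H * (a n \<omega>)\<^sup>2 \<le> Z n \<omega> * (a n \<omega>)\<^sup>2" by (rule mult_right_mono) simp
      then show ?case by (simp add: power2_eq_square mult_ac)
    qed
  qed (intro integrable_intros)+
  finally have 2: "1 / H * E2 n \<le> expectation (\<lambda>\<omega>. (a n \<omega> * Z n \<omega>) * a n \<omega>)" .
  have "(1 - b) * (1 / H * E2 n) \<le> (1 - \<beta> n) * expectation (\<lambda>\<omega>. (a n \<omega> * Z n \<omega>) * a n \<omega>)"
    using momentum(5)[of n] momentum(6) H_pos E2_nonneg[of n] 2 by (intro mult_mono) auto
  then show ?thesis using 1 by simp
qed

section \<open>Summation over the iterations\<close>

definition p :: real where "p = (1 - b) / H"
text \<open>The one-step loss in \<open>A_drift\<close>; it also dominates the loss in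
  \<open>A_minus_expectation_au\<close>. Momentum carries past losses forward with discount
  \<open>b\<close>, which is what \<open>N\<close> accumulates.\<close>

definition R :: "real \<Rightarrow> nat \<Rightarrow> real" where
  "R \<delta> n = D * B / h0 * \<eta> n + (\<delta> * E2 n + \<kappa>\<^sup>2 / \<delta> * Q n)"
definition N :: "real \<Rightarrow> nat \<Rightarrow> real" where "N \<delta> = rec_nat 0 (\<lambda>n r. b * (r + R \<delta> n))"

lemma N_simps: "N \<delta> 0 = 0" "N \<delta> (Suc n) = b * (N \<delta> n + R \<delta> n)"
  by (simp_all add: N_def)

lemma p_pos: "0 < p" using H_pos momentum by (simp add: p_def)

lemma b_nonneg: "0 \<le> b" using momentum(4,5)[of 0] by linarith

lemma \<eta>_nonneg: "0 \<le> \<eta> n"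
  using mult_nonneg_nonneg[of C0 "\<alpha> n"] steps(1,5)[of n] steps(3) by linarith

lemma R_nonneg: "0 < \<delta> \<Longrightarrow> 0 \<le> R \<delta> n"
  unfolding R_def using bounds \<eta>_nonneg[of n] E2_nonneg[of n] Q_nonneg[of n] by simp

lemma N_nonneg: "0 < \<delta> \<Longrightarrow> 0 \<le> N \<delta> n"
  by (induction n) (simp_all add: N_simps R_nonneg b_nonneg)

text \<open>Induction along the momentum recursion: the carried-over correlation enters with weight
  at most \<open>b\<close>, so its possible negative part grows only through discounted
  losses.\<close>

lemma A_ge:
  assumes "0 < \<delta>"
  shows "A n \<ge> p * E2 n - N \<delta> n"
proof (induction n)
  case 0
  have "expectation (\<lambda>\<omega>. a 0 \<omega> * m 0 \<omega> * Z 0 \<omega>) = expectation (\<lambda>_. 0)"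
    by (rule Bochner_Integration.integral_cong) (auto simp: momentum(1))
  with A_momentum[of 0] show ?case by (simp add: N_simps p_def)
next
  case (Suc n)
  let ?X = "expectation (\<lambda>\<omega>. a (Suc n) \<omega> * m (Suc n) \<omega> * Z (Suc n) \<omega>)"
  let ?Y = "N \<delta> n + R \<delta> n"
  \<comment> \<open>The contribution \<open>p * E2 n\<close> of the preceding iteration is
    nonnegative and is dropped here.\<close>
  have "- ?Y \<le> ?X"
    using A_drift[OF assms, of n] Suc mult_nonneg_nonneg[OF less_imp_le[OF p_pos] E2_nonneg[of n]]
    unfolding R_def by linarith
  then have "\<beta> (Suc n) * (- ?Y) \<le> \<beta> (Suc n) * ?X"
    by (rule mult_left_mono) (rule momentum)
  moreover have "\<beta> (Suc n) * ?Y \<le> b * ?Y"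
    using R_nonneg[OF assms] N_nonneg[OF assms] by (intro mult_right_mono momentum add_nonneg_nonneg)
  ultimately show ?case
    using A_momentum[of "Suc n"] unfolding N_simps p_def by linarith
qed

lemma expectation_au_ge:
  assumes "0 < \<delta>"
  shows "expectation (\<lambda>\<omega>. a n \<omega> * u n \<omega>) \<ge> p * E2 n - (N \<delta> n + R \<delta> n)"
proof -
  have "0 \<le> D * B / h0 * \<eta> n" using bounds \<eta>_nonneg[of n] by simp
  then show ?thesis
    using A_minus_expectation_au[OF assms, of n] A_ge[OF assms, of n] unfolding R_def by linarith
qed

text \<open>The telescoping part of \<open>Q_le\<close> needs monotone weights, hence \<alpha> and
  not \<eta>; the drift part is moved to \<eta> by \<open>C0 * \<alpha> n \<le> \<eta> n\<close> and
  is then summable.\<close>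

lemma sum_\<alpha>_Q_le: "(\<Sum>n<K. \<alpha> n * Q n) \<le> \<alpha> 0 * H\<^sup>2 + 2 * H / C0 * (\<Sum>n. \<eta> n * s n)"
proof -
  have "(\<Sum>n<K. \<alpha> n * Q n) \<le> (\<Sum>n<K. \<alpha> n * (q (Suc n) - q n) + 2 * H / C0 * (\<eta> n * s n))"
  proof (rule sum_mono)
    fix n
    have "\<alpha> n * Q n \<le> \<alpha> n * (q (Suc n) - q n + 2 * H * s n)"
      by (intro mult_left_mono Q_le steps)
    also have "\<dots> = \<alpha> n * (q (Suc n) - q n) + 2 * H / C0 * ((C0 * \<alpha> n) * s n)"
      using steps(3) by (simp add: field_simps)
    also have "\<dots> \<le> \<alpha> n * (q (Suc n) - q n) + 2 * H / C0 * (\<eta> n * s n)"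
      using steps H_pos s_nonneg by (intro add_left_mono mult_left_mono mult_right_mono) auto
    finally show "\<alpha> n * Q n \<le> \<alpha> n * (q (Suc n) - q n) + 2 * H / C0 * (\<eta> n * s n)" .
  qed
  also have "\<dots> = (\<Sum>n<K. \<alpha> n * (q (Suc n) - q n)) + 2 * H / C0 * (\<Sum>n<K. \<eta> n * s n)"
    by (simp add: sum.distrib sum_distrib_left)
  also have "(\<Sum>n<K. \<alpha> n * (q (Suc n) - q n)) \<le> \<alpha> 0 * H\<^sup>2"
    by (rule weighted_sum_increments_le) (simp_all add: steps q_bounds)
  also have "2 * H / C0 * (\<Sum>n<K. \<eta> n * s n) \<le> 2 * H / C0 * (\<Sum>n. \<eta> n * s n)"
    using steps H_pos s_nonneg \<eta>_nonneg by (intro mult_left_mono sum_le_suminf) auto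
  finally show ?thesis by simp
qed

text \<open>All losses are either summable or a small multiple of the main term, so half of the main
  term survives; the constant \<open>C\<close> does not depend on \<open>K\<close>. This is the
  estimate exported for each coordinate.\<close>

lemma sum_expectation_square_le:
  "\<exists>C. \<forall>K. (1 - b) / (2 * H) * (\<Sum>n<K. \<eta> n * expectation (\<lambda>\<omega>. (a n \<omega>)\<^sup>2))
      \<le> (\<Sum>n<K. \<eta> n * expectation (\<lambda>\<omega>. a n \<omega> * u n \<omega>)) + C"
proof -
  \<comment> \<open>Chosen so that \<open>C0' / (1 - b) * (\<delta> / C0)\<close> equals
    \<open>p / 2\<close>: the gradient part of the losses eats half of the main term.\<close>
  define \<delta> where "\<delta> = p * C0 * (1 - b) / (2 * C0')"
  have \<delta>: "0 < \<delta>" using p_pos steps momentum by (simp add: \<delta>_def)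
  define C1 where "C1 = D * B / h0"
  have C1: "0 \<le> C1" using bounds by (simp add: C1_def)
  define C where "C = C0' / (1 - b) * (C1 / C0 * (\<Sum>n. (\<eta> n)\<^sup>2)
    + \<kappa>\<^sup>2 / \<delta> * (\<alpha> 0 * H\<^sup>2 + 2 * H / C0 * (\<Sum>n. \<eta> n * s n)))"
  have "p / 2 * (\<Sum>n<K. \<eta> n * E2 n) \<le> (\<Sum>n<K. \<eta> n * expectation (\<lambda>\<omega>. a n \<omega> * u n \<omega>)) + C" for K
  proof -
    let ?NR = "\<lambda>n. N \<delta> n + R \<delta> n"
    have NR: "0 \<le> ?NR n" for n using N_nonneg[OF \<delta>] R_nonneg[OF \<delta>] by simp
    have \<alpha>\<eta>: "\<alpha> n \<le> \<eta> n / C0" for n using steps(3) steps(5)[of n] by (simp add: field_simps)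
    have "(\<Sum>n<K. \<alpha> n * R \<delta> n)
      \<le> (\<Sum>n<K. C1 / C0 * (\<eta> n)\<^sup>2 + \<delta> / C0 * (\<eta> n * E2 n) + \<kappa>\<^sup>2 / \<delta> * (\<alpha> n * Q n))"
    proof (rule sum_mono)
      fix n
      \<comment> \<open>Only the term with \<open>Q n\<close> keeps the weight \<alpha>, in which
        its sum is controlled; the other two pass to \<eta>.\<close>
      have "\<alpha> n * (C1 * \<eta> n + \<delta> * E2 n) \<le> \<eta> n / C0 * (C1 * \<eta> n + \<delta> * E2 n)"
        using \<alpha>\<eta> C1 \<delta> \<eta>_nonneg[of n] E2_nonneg[of n] by (intro mult_right_mono) auto
      then show "\<alpha> n * R \<delta> n
        \<le> C1 / C0 * (\<eta> n)\<^sup>2 + \<delta> / C0 * (\<eta> n * E2 n) + \<kappa>\<^sup>2 / \<delta> * (\<alpha> n * Q n)"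
        unfolding R_def C1_def[symmetric]
        by (simp add: algebra_simps power2_eq_square add_divide_distrib)
    qed
    also have "\<dots> = C1 / C0 * (\<Sum>n<K. (\<eta> n)\<^sup>2) + \<delta> / C0 * (\<Sum>n<K. \<eta> n * E2 n)
        + \<kappa>\<^sup>2 / \<delta> * (\<Sum>n<K. \<alpha> n * Q n)"
      by (simp only: sum.distrib sum_distrib_left)
    also have "\<dots> \<le> C1 / C0 * (\<Sum>n. (\<eta> n)\<^sup>2) + \<delta> / C0 * (\<Sum>n<K. \<eta> n * E2 n)
        + \<kappa>\<^sup>2 / \<delta> * (\<alpha> 0 * H\<^sup>2 + 2 * H / C0 * (\<Sum>n. \<eta> n * s n))"
      using C1 \<delta> steps
      by (intro add_mono mult_left_mono sum_\<alpha>_Q_le sum_le_suminf order_refl) auto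
    finally have "C0' / (1 - b) * (\<Sum>n<K. \<alpha> n * R \<delta> n)
        \<le> C0' / (1 - b) * (C1 / C0 * (\<Sum>n. (\<eta> n)\<^sup>2) + \<delta> / C0 * (\<Sum>n<K. \<eta> n * E2 n)
        + \<kappa>\<^sup>2 / \<delta> * (\<alpha> 0 * H\<^sup>2 + 2 * H / C0 * (\<Sum>n. \<eta> n * s n)))"
      using steps momentum by (intro mult_left_mono) auto
    also have "\<dots> = C + C0' / (1 - b) * (\<delta> / C0) * (\<Sum>n<K. \<eta> n * E2 n)"
      unfolding C_def by (simp only: distrib_left mult.assoc)
    also have "C0' / (1 - b) * (\<delta> / C0) = p / 2"
      using steps(3,4) momentum(6) by (simp add: \<delta>_def)
    finally have R: "C0' / (1 - b) * (\<Sum>n<K. \<alpha> n * R \<delta> n) \<le> C + p / 2 * (\<Sum>n<K. \<eta> n * E2 n)" .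
    \<comment> \<open>The weights are exchanged for the monotone \<alpha>, as
      \<open>weighted_sum_linear_recursion\<close> requires.\<close>
    have "(\<Sum>n<K. \<eta> n * ?NR n) \<le> (\<Sum>n<K. C0' * (\<alpha> n * ?NR n))"
      using steps(6) NR by (intro sum_mono) (simp add: mult_right_mono mult.assoc[symmetric])
    also have "\<dots> = C0' / (1 - b) * ((1 - b) * (\<Sum>n<K. \<alpha> n * ?NR n))"
      using momentum(6) by (simp add: sum_distrib_left)
    also have "\<dots> \<le> C0' / (1 - b) * (\<Sum>n<K. \<alpha> n * R \<delta> n)"
      using steps momentum(6) R_nonneg[OF \<delta>] b_nonneg
      by (intro mult_left_mono weighted_sum_linear_recursion) (auto simp: N_simps)
    finally have NR_sum: "(\<Sum>n<K. \<eta> n * ?NR n) \<le> C + p / 2 * (\<Sum>n<K. \<eta> n * E2 n)" using R by simp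
    have "(\<Sum>n<K. \<eta> n * (p * E2 n - ?NR n)) \<le> (\<Sum>n<K. \<eta> n * expectation (\<lambda>\<omega>. a n \<omega> * u n \<omega>))"
      by (intro sum_mono mult_left_mono expectation_au_ge \<delta> \<eta>_nonneg)
    moreover have "(\<Sum>n<K. \<eta> n * (p * E2 n - ?NR n)) = p * (\<Sum>n<K. \<eta> n * E2 n) - (\<Sum>n<K. \<eta> n * ?NR n)"
      unfolding sum_distrib_left sum_subtractf[symmetric] by (intro sum.cong) (auto simp: algebra_simps)
    ultimately show ?thesis using NR_sum by (simp add: field_simps)
  qed
  moreover have "p / 2 = (1 - b) / (2 * H)" by (simp add: p_def)
  ultimately show ?thesis unfolding E2_def by (intro exI[of _ C] allI) simp
qed

end

section \<open>Smooth functions, histories and elementary estimates\<close>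

text \<open>The mean value theorem along the segment, with the Lipschitz bound at the intermediate
  point. This gives the constant \<open>L\<close> instead of the sharp \<open>L / 2\<close>; only
  the quadratic order matters later.\<close>

lemma smooth_first_order_error:
  fixes f :: "'a::real_inner \<Rightarrow> real"
  assumes grad: "\<And>y. GDERIV f y :> f' y" and lip: "\<And>y z. norm (f' y - f' z) \<le> L * norm (y - z)"
  shows "\<bar>f z - f y - f' y \<bullet> (z - y)\<bar> \<le> L * (norm (z - y))\<^sup>2"
proof -
  define \<phi> where "\<phi> t = f (y + t *\<^sub>R (z - y))" for t
  have deriv: "(\<phi> has_real_derivative (z - y) \<bullet> f' (y + t *\<^sub>R (z - y))) (at t)" for t
  proof -
    have "((\<lambda>t. y + t *\<^sub>R (z - y)) has_derivative (\<lambda>h. h *\<^sub>R (z - y))) (at t)"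
      by (auto intro!: derivative_eq_intros)
    from diff_chain_at[OF this grad[of "y + t *\<^sub>R (z - y)", unfolded gderiv_def]] show ?thesis
      by (simp add: o_def \<phi>_def[abs_def] has_field_derivative_def mult.commute[of _ "(z - y) \<bullet> _"])
  qed
  obtain t where t: "0 < t" "t < 1" "\<phi> 1 - \<phi> 0 = (1 - 0) * ((z - y) \<bullet> f' (y + t *\<^sub>R (z - y)))"
    using MVT2[OF zero_less_one deriv] by blast
  have "f z - f y - f' y \<bullet> (z - y) = (f' (y + t *\<^sub>R (z - y)) - f' y) \<bullet> (z - y)"
    using t(3) by (simp add: \<phi>_def inner_diff_left[of _ _ "z - y"] inner_commute[of "z - y"])
  also have "\<bar>\<dots>\<bar> \<le> norm (f' (y + t *\<^sub>R (z - y)) - f' y) * norm (z - y)"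
    by (rule Cauchy_Schwarz_ineq2)
  also have "\<dots> \<le> (L * (t * norm (z - y))) * norm (z - y)"
    using lip[of "y + t *\<^sub>R (z - y)" y] t by (intro mult_right_mono) auto
  also have "\<dots> \<le> L * (norm (z - y))\<^sup>2"
  proof -
    have "0 \<le> L * norm (z - y)" using lip[of z y] norm_ge_zero order_trans by blast
    then have "t * (L * norm (z - y) * norm (z - y)) \<le> 1 * (L * norm (z - y) * norm (z - y))"
      using t by (intro mult_right_mono) auto
    then show ?thesis by (simp add: power2_eq_square mult_ac)
  qed
  finally show ?thesis .
qed

lemma borel_measurable_vec_nth:
  fixes X :: "'w \<Rightarrow> real ^ 'd::finite"
  shows "X \<in> borel_measurable M \<Longrightarrow> (\<lambda>\<omega>. X \<omega> $ i) \<in> borel_measurable M"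
  by (rule measurable_compose[OF _ borel_measurable_nth])

lemma borel_measurable_vec_lambda:
  fixes X :: "'w \<Rightarrow> 'd::finite \<Rightarrow> real"
  assumes "\<And>i. (\<lambda>\<omega>. X \<omega> i) \<in> borel_measurable M"
  shows "(\<lambda>\<omega>. \<chi> i. X \<omega> i) \<in> borel_measurable M"
  by (subst borel_measurable_euclidean_space) (use assms in \<open>auto simp: Basis_vec_def inner_axis\<close>)

lemma sets_history:
  "sets (history M x k) = sigma_sets (space M) {x j -` B \<inter> space M | j B. j \<in> {1..k} \<and> B \<in> sets borel}"
  unfolding history_def by (rule sets_measure_of) auto

lemma space_history: "space (history M x k) = space M"
  unfolding history_def by (rule space_measure_of) auto

lemma measurable_history: "1 \<le> j \<Longrightarrow> j \<le> k \<Longrightarrow> x j \<in> borel_measurable (history M x k)"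
  by (rule measurableI) (auto simp: space_history sets_history intro: sigma_sets.Basic)

lemma subalgebra_history:
  assumes "\<And>j. 1 \<le> j \<Longrightarrow> j \<le> k \<Longrightarrow> x j \<in> borel_measurable M"
  shows "subalgebra M (history M x k)"
  unfolding subalgebra_def sets_history space_history
  using assms by (auto intro!: sets.sigma_sets_subset measurable_sets)

lemma subalgebra_history_mono: "k \<le> l \<Longrightarrow> subalgebra (history M x l) (history M x k)"
  unfolding subalgebra_def sets_history space_history
  by (intro conjI refl sigma_sets_subseteq) force

text \<open>Each step is a convex combination inside an interval that contains the initial value 0.
  Serves for both moment estimates.\<close>

lemma convex_recursion_bounds:
  fixes m g c :: "nat \<Rightarrow> real"
  assumes "m 0 = 0" "l \<le> 0" "0 \<le> r"
    and "\<And>k. k \<ge> 1 \<Longrightarrow> 0 \<le> c k \<and> c k \<le> 1" "\<And>k. k \<ge> 1 \<Longrightarrow> l \<le> g k \<and> g k \<le> r"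
    and "\<And>k. k \<ge> 1 \<Longrightarrow> m k = c k * m (k - 1) + (1 - c k) * g k"
  shows "l \<le> m k \<and> m k \<le> r"
proof (induction k)
  case (Suc k)
  have c: "0 \<le> c (Suc k)" "0 \<le> 1 - c (Suc k)" and m: "m (Suc k) = c (Suc k) * m k + (1 - c (Suc k)) * g (Suc k)"
    and g: "l \<le> g (Suc k)" "g (Suc k) \<le> r"
    using assms(4-6)[of "Suc k"] by auto
  have "c (Suc k) * l + (1 - c (Suc k)) * l \<le> m (Suc k)" "m (Suc k) \<le> c (Suc k) * r + (1 - c (Suc k)) * r"
    unfolding m using Suc c g by (intro add_mono mult_left_mono; simp)+
  then show ?case by (simp add: algebra_simps)
qed (use assms in simp)

text \<open>Multiply by the conjugate sum of roots, which is at least \<open>sqrt e\<close>.\<close>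

lemma abs_sqrt_diff_le:
  assumes "0 < e" "e \<le> x" "e \<le> y"
  shows "\<bar>sqrt x - sqrt y\<bar> \<le> \<bar>x - y\<bar> / sqrt e"
proof -
  have "sqrt e \<le> sqrt x" "0 \<le> sqrt y" using assms by auto
  then have "\<bar>sqrt x - sqrt y\<bar> * sqrt e \<le> \<bar>sqrt x - sqrt y\<bar> * (sqrt x + sqrt y)"
    by (intro mult_left_mono add_increasing2) auto
  also have "\<dots> = \<bar>(sqrt x - sqrt y) * (sqrt x + sqrt y)\<bar>"
    using assms by (simp add: abs_mult)
  also have "(sqrt x - sqrt y) * (sqrt x + sqrt y) = x - y"
    using assms by (simp add: algebra_simps)
  finally show ?thesis using assms by (simp add: field_simps)
qed

text \<open>By monotone convergence the sum has finite integral, hence is finite almost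
  everywhere.\<close>

lemma AE_summable_of_summable_integral:
  fixes W :: "nat \<Rightarrow> 'w \<Rightarrow> real"
  assumes int: "\<And>n. integrable M (W n)" and nonneg: "\<And>n \<omega>. 0 \<le> W n \<omega>"
    and sum: "summable (\<lambda>n. \<integral>\<omega>. W n \<omega> \<partial>M)"
  shows "AE \<omega> in M. summable (\<lambda>n. W n \<omega>)"
proof -
  have [measurable]: "W n \<in> borel_measurable M" for n using int by auto
  have "(\<integral>\<^sup>+\<omega>. (\<Sum>n. ennreal (W n \<omega>)) \<partial>M) = (\<Sum>n. \<integral>\<^sup>+\<omega>. ennreal (W n \<omega>) \<partial>M)"
    by (rule nn_integral_suminf) measurable
  also have "\<dots> = (\<Sum>n. ennreal (\<integral>\<omega>. W n \<omega> \<partial>M))"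
    using int nonneg by (simp add: nn_integral_eq_integral)
  also have "\<dots> = ennreal (\<Sum>n. \<integral>\<omega>. W n \<omega> \<partial>M)"
    using nonneg sum by (intro suminf_ennreal2) auto
  finally have "(\<integral>\<^sup>+\<omega>. (\<Sum>n. ennreal (W n \<omega>)) \<partial>M) \<noteq> \<infinity>" by simp
  then have "AE \<omega> in M. (\<Sum>n. ennreal (W n \<omega>)) \<noteq> \<infinity>"
    by (intro nn_integral_PInf_AE) measurable
  then show ?thesis
    by eventually_elim (auto intro: summable_suminf_not_top nonneg)
qed

section \<open>Convergence of the objective values\<close>

theorem theorem12:
  fixes M :: "'w measure" and P :: "'s measure"
    and loss :: "real ^ 'd \<Rightarrow> 's \<Rightarrow> real"
    and f :: "real ^ 'd \<Rightarrow> real" and grad_f :: "real ^ 'd \<Rightarrow> real ^ 'd::finite"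
    and \<xi> :: "nat \<Rightarrow> 'w \<Rightarrow> 's"
    and g m v x :: "nat \<Rightarrow> 'w \<Rightarrow> real ^ 'd"
    and x1 :: "real ^ 'd"
    and \<eta> \<beta> \<theta> \<alpha> :: "nat \<Rightarrow> real"
    and \<epsilon> \<beta>_max G L C0 C0' \<mu> fstar :: real
  assumes prob_spaces: "prob_space M" "prob_space P"
    and f_expectation: "\<And>y. integrable P (loss y)" "\<And>y. f y = (\<integral>s. loss y s \<partial>P)"
    and f_gradient: "\<And>y. GDERIV f y :> grad_f y"
    and params: "\<And>k. k \<ge> 1 \<Longrightarrow> \<eta> k > 0" "\<epsilon> > 0"
      "\<And>k. k \<ge> 1 \<Longrightarrow> 0 \<le> \<beta> k \<and> \<beta> k \<le> \<beta>_max" "\<beta>_max < 1"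
      "\<And>k. k \<ge> 1 \<Longrightarrow> 0 < \<theta> k \<and> \<theta> k < 1"
    and samples: "\<And>k. k \<ge> 1 \<Longrightarrow> \<xi> k \<in> measurable M P"
      "\<And>k. k \<ge> 1 \<Longrightarrow> distr M P (\<xi> k) = P"
    and g_random: "\<And>k. k \<ge> 1 \<Longrightarrow> g k \<in> borel_measurable M"
    and adam: "\<And>\<omega>. \<omega> \<in> space M \<Longrightarrow>
      adam \<eta> \<epsilon> \<beta> \<theta> x1 loss (\<lambda>k. \<xi> k \<omega>) (\<lambda>k. g k \<omega>) (\<lambda>k. m k \<omega>) (\<lambda>k. v k \<omega>) (\<lambda>k. x k \<omega>)"
    and unbiased: "\<And>k. k \<ge> 1 \<Longrightarrow>
      AE \<omega> in M. vec_cond_exp M (history M x k) (g k) \<omega> = grad_f (x k \<omega>)"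
    and g_bounded: "G > 0" "\<And>k. k \<ge> 1 \<Longrightarrow> AE \<omega> in M. norm (g k \<omega>) \<le> G"
    and f_bounded_below: "bdd_below (range f)" "fstar = (INF y. f y)"
    and L_smooth: "L > 0" "\<And>y z. norm (grad_f y - grad_f z) \<le> L * norm (y - z)"
    and step_sizes: "filterlim (\<lambda>n. \<Sum>k=1..n. \<eta> k) at_top sequentially"
      "summable (\<lambda>k. (\<eta> (Suc k))\<^sup>2)"
      "summable (\<lambda>k. \<eta> (Suc k) * (1 - \<theta> (Suc k)))"
    and step_comparable: "\<And>j k. 1 \<le> j \<Longrightarrow> j \<le> k \<Longrightarrow> \<alpha> k \<le> \<alpha> j"
      "C0 > 0" "C0' > 0"
      "\<And>k. k \<ge> 1 \<Longrightarrow> C0 * \<alpha> k \<le> \<eta> k \<and> \<eta> k \<le> C0' * \<alpha> k"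
    and PL: "\<mu> > 0" "\<And>y. (norm (grad_f y))\<^sup>2 \<ge> 2 * \<mu> * (f y - fstar)"
  shows "(AE \<omega> in M. (\<lambda>k. f (x k \<omega>)) \<longlonglongrightarrow> fstar) \<and>
    (\<forall>k\<ge>1. integrable M (\<lambda>\<omega>. f (x k \<omega>))) \<and>
    (\<lambda>k. \<integral>\<omega>. f (x k \<omega>) \<partial>M) \<longlonglongrightarrow> fstar"
proof -
  interpret prob_space M by (rule prob_spaces)
  have f_cont: "continuous_on UNIV f"
    using f_gradient unfolding gderiv_def continuous_on_eq_continuous_at[OF open_UNIV]
    by (blast intro: has_derivative_continuous)
  have "L-lipschitz_on UNIV grad_f"
    using L_smooth by (intro lipschitz_onI) (auto simp: dist_norm)
  then have grad_cont: "continuous_on UNIV grad_f" by (rule lipschitz_on_continuous_on)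
  have [measurable]: "f \<in> borel_measurable borel" "grad_f \<in> borel_measurable borel"
    using f_cont grad_cont by (simp_all add: borel_measurable_continuous_onI)
  have fstar_le: "fstar \<le> f y" for y
    unfolding f_bounded_below(2) by (rule cINF_lower[OF f_bounded_below(1)]) simp

  have init: "m 0 \<omega> = 0" "v 0 \<omega> = 0" "x 1 \<omega> = x1"
    and m_step: "k \<ge> 1 \<Longrightarrow> m k \<omega> = \<beta> k *\<^sub>R m (k - 1) \<omega> + (1 - \<beta> k) *\<^sub>R g k \<omega>"
    and v_step: "k \<ge> 1 \<Longrightarrow> v k \<omega> = \<theta> k *\<^sub>R v (k - 1) \<omega> + (1 - \<theta> k) *\<^sub>R (\<chi> i. (g k \<omega> $ i)\<^sup>2)"
    and x_step: "k \<ge> 1 \<Longrightarrow>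
      x (k + 1) \<omega> = x k \<omega> - \<eta> k *\<^sub>R (\<chi> i. m k \<omega> $ i / sqrt (v k \<omega> $ i + \<epsilon>))"
    if "\<omega> \<in> space M" for k \<omega>
    using adam[OF that] unfolding adam_def by auto

  \<comment> \<open>Measurability of moments and iterates\<close>
  have g_coord [measurable]: "(\<lambda>\<omega>. g k \<omega> $ i) \<in> borel_measurable M" if "k \<ge> 1" for k i
    by (intro borel_measurable_vec_nth g_random that)
  \<comment> \<open>The recursions are known only on \<open>space M\<close>, so measurability is
    transferred from their right-hand sides by \<open>measurable_cong\<close>.\<close>
  have m_meas [measurable]: "(\<lambda>\<omega>. m k \<omega> $ i) \<in> borel_measurable M" for k i
  proof (induction k)
    case 0
    show ?case by (subst measurable_cong[where g = "\<lambda>_. 0"]) (auto simp: init)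
  next
    case (Suc k)
    then have "(\<lambda>\<omega>. \<beta> (Suc k) * m k \<omega> $ i + (1 - \<beta> (Suc k)) * g (Suc k) \<omega> $ i) \<in> borel_measurable M"
      using g_coord[of "Suc k" i] by simp
    then show ?case by (subst measurable_cong) (auto simp: m_step)
  qed
  have v_meas [measurable]: "(\<lambda>\<omega>. v k \<omega> $ i) \<in> borel_measurable M" for k i
  proof (induction k)
    case 0
    show ?case by (subst measurable_cong[where g = "\<lambda>_. 0"]) (auto simp: init)
  next
    case (Suc k)
    then have "(\<lambda>\<omega>. \<theta> (Suc k) * v k \<omega> $ i + (1 - \<theta> (Suc k)) * (g (Suc k) \<omega> $ i)\<^sup>2) \<in> borel_measurable M"
      using g_coord[of "Suc k" i] by simp
    then show ?case by (subst measurable_cong) (auto simp: v_step)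
  qed
  have h_meas: "(\<lambda>\<omega>. sqrt (v k \<omega> $ i + \<epsilon>)) \<in> borel_measurable M" for k i
    by (rule measurable_compose[OF borel_measurable_add[OF v_meas borel_measurable_const] borel_measurable_sqrt])
  \<comment> \<open>Indexed by \<open>Suc n\<close> because the iterates start at
    \<open>x 1\<close>.\<close>
  have x_meas [measurable]: "x (Suc n) \<in> borel_measurable M" for n
  proof (induction n)
    case 0
    show ?case by (subst measurable_cong[where g = "\<lambda>_. x1"]) (auto simp: init[unfolded One_nat_def])
  next
    case (Suc n)
    have "(\<lambda>\<omega>. x (Suc n) \<omega> - \<eta> (Suc n) *\<^sub>R (\<chi> i. m (Suc n) \<omega> $ i / sqrt (v (Suc n) \<omega> $ i + \<epsilon>)))
      \<in> borel_measurable M"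
      using Suc by (intro borel_measurable_diff borel_measurable_scaleR borel_measurable_const
        borel_measurable_vec_lambda borel_measurable_divide m_meas h_meas)
    then show ?case by (subst measurable_cong) (auto simp: x_step[of _ "Suc n", simplified])
  qed
  have subalg: "subalgebra M (history M x k)" for k
  proof (rule subalgebra_history)
    show "x j \<in> borel_measurable M" if "1 \<le> j" for j
      using x_meas[of "j - 1"] that by simp
  qed

  \<comment> \<open>Almost sure bounds\<close>
  \<comment> \<open>One null set serves all iterations, so the moments can be bounded by induction
    along a fixed sample path.\<close>
  have g_bound: "AE \<omega> in M. \<forall>k\<ge>1. norm (g k \<omega>) \<le> G"
    using g_bounded(2) by (auto simp: AE_all_countable)
  have mv_bounds: "AE \<omega> in M. \<forall>k i. \<bar>m k \<omega> $ i\<bar> \<le> G \<and> 0 \<le> v k \<omega> $ i \<and> v k \<omega> $ i \<le> G\<^sup>2"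
    using g_bound AE_space
  proof eventually_elim
    case (elim \<omega>)
    have g: "\<bar>g k \<omega> $ i\<bar> \<le> G" if "k \<ge> 1" for k i
      using elim(1) that component_le_norm_cart[of "g k \<omega>" i] by force
    have "- G \<le> m k \<omega> $ i \<and> m k \<omega> $ i \<le> G" for k i
    proof (rule convex_recursion_bounds[where c = \<beta> and g = "\<lambda>k. g k \<omega> $ i"])
      fix k :: nat assume k: "k \<ge> 1"
      show "0 \<le> \<beta> k \<and> \<beta> k \<le> 1" using params(3)[OF k] params(4) by simp
      show "- G \<le> g k \<omega> $ i \<and> g k \<omega> $ i \<le> G" using g[OF k, of i] by linarith
      show "m k \<omega> $ i = \<beta> k * m (k - 1) \<omega> $ i + (1 - \<beta> k) * g k \<omega> $ i"
        by (subst m_step[OF elim(2) k]) simp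
    qed (use g_bounded(1) in \<open>simp_all add: init[OF elim(2)]\<close>)
    moreover have "0 \<le> v k \<omega> $ i \<and> v k \<omega> $ i \<le> G\<^sup>2" for k i
    proof (rule convex_recursion_bounds[where c = \<theta> and g = "\<lambda>k. (g k \<omega> $ i)\<^sup>2"])
      fix k :: nat assume k: "k \<ge> 1"
      show "0 \<le> \<theta> k \<and> \<theta> k \<le> 1" using params(5)[OF k] by simp
      show "0 \<le> (g k \<omega> $ i)\<^sup>2 \<and> (g k \<omega> $ i)\<^sup>2 \<le> G\<^sup>2"
        using power_mono[OF g[OF k, of i], of 2] by simp
      show "v k \<omega> $ i = \<theta> k * v (k - 1) \<omega> $ i + (1 - \<theta> k) * (g k \<omega> $ i)\<^sup>2"
        by (subst v_step[OF elim(2) k]) simp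
    qed (simp_all add: init[OF elim(2)])
    ultimately show ?case by (simp add: abs_le_iff minus_le_iff)
  qed

  define a where "a i n \<omega> = grad_f (x (Suc n) \<omega>) $ i" for i n \<omega>
  \<comment> \<open>Defined from two consecutive iterates, so that measurability in the later
    history is evident; \<open>u_eq\<close> identifies it with the normalized momentum.\<close>
  define u where "u i n \<omega> = (x (Suc n) \<omega> $ i - x (Suc (Suc n)) \<omega> $ i) / \<eta> (Suc n)" for i n \<omega>
  define h where "h i n \<omega> = sqrt (v n \<omega> $ i + \<epsilon>)" for i n \<omega>
  define H where "H = sqrt (G\<^sup>2 + \<epsilon>)"
  \<comment> \<open>The factor \<open>CARD('d)\<close> in \<open>U\<close> and \<open>Gd\<close>
    comes from bounding the Euclidean norm by the sum of absolute coordinates.\<close>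
  define U where "U = CARD('d) * (G / sqrt \<epsilon>)"
  define Gd where "Gd = CARD('d) * G"

  have u_eq: "u i n \<omega> = m (Suc n) \<omega> $ i / h i (Suc n) \<omega>" if "\<omega> \<in> space M" for i n \<omega>
    using x_step[OF that, of "Suc n"] params(1)[of "Suc n"] by (simp add: u_def h_def)
  \<comment> \<open>The true gradient along the iterates inherits the bound \<open>G\<close>, being
    a conditional expectation of the bounded stochastic gradient.\<close>
  have a_bound: "AE \<omega> in M. \<bar>a i n \<omega>\<bar> \<le> G"
    and a_unbiased: "AE \<omega> in M. real_cond_exp M (history M x (Suc n)) (\<lambda>\<omega>. g (Suc n) \<omega> $ i) \<omega> = a i n \<omega>" for i n
  proof -
    interpret H: finite_measure_subalgebra M "history M x (Suc n)"
      by unfold_locales (rule subalg)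
    show unb: "AE \<omega> in M. real_cond_exp M (history M x (Suc n)) (\<lambda>\<omega>. g (Suc n) \<omega> $ i) \<omega> = a i n \<omega>"
      using unbiased[of "Suc n", simplified]
    proof eventually_elim
      case (elim \<omega>)
      then have "vec_cond_exp M (history M x (Suc n)) (g (Suc n)) \<omega> $ i = a i n \<omega>" by (simp add: a_def)
      then show ?case by (simp add: vec_cond_exp_def)
    qed
    have gb: "AE \<omega> in M. \<bar>g (Suc n) \<omega> $ i\<bar> \<le> G"
      using g_bounded(2)[of "Suc n", simplified]
      by eventually_elim (rule order_trans[OF component_le_norm_cart])
    then have int: "integrable M (\<lambda>\<omega>. g (Suc n) \<omega> $ i)"
      by (intro bounded_rv_integrable bounded_rvI g_coord) auto
    have "AE \<omega> in M. - G \<le> g (Suc n) \<omega> $ i" "AE \<omega> in M. g (Suc n) \<omega> $ i \<le> G"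
      using gb by (eventually_elim, simp)+
    from H.real_cond_exp_ge_c[OF int this(1)] H.real_cond_exp_le_c[OF int this(2)] unb
    show "AE \<omega> in M. \<bar>a i n \<omega>\<bar> \<le> G" by eventually_elim simp
  qed
  have grad_bound: "AE \<omega> in M. norm (grad_f (x (Suc n) \<omega>)) \<le> Gd" for n
  proof -
    have "AE \<omega> in M. \<forall>i. \<bar>a i n \<omega>\<bar> \<le> G" using a_bound by (simp add: AE_all_countable)
    then show ?thesis
    proof eventually_elim
      case (elim \<omega>)
      have "norm (grad_f (x (Suc n) \<omega>)) \<le> (\<Sum>i\<in>UNIV. \<bar>a i n \<omega>\<bar>)"
        unfolding a_def by (rule norm_le_l1_cart)
      also have "\<dots> \<le> (\<Sum>i\<in>(UNIV :: 'd set). G)" using elim by (intro sum_mono) auto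
      finally show ?case by (simp add: Gd_def)
    qed
  qed
  have u_bound: "AE \<omega> in M. \<forall>n i. \<bar>u i n \<omega>\<bar> \<le> G / sqrt \<epsilon>"
    using mv_bounds AE_space
  proof eventually_elim
    case (elim \<omega>)
    then show ?case using params(2) g_bounded(1)
      by (auto simp: u_eq h_def abs_div intro!: frac_le)
  qed
  have step_bound: "AE \<omega> in M. \<forall>n. norm (x (Suc (Suc n)) \<omega> - x (Suc n) \<omega>) \<le> U * \<eta> (Suc n)"
    using u_bound
  proof (rule AE_mp, intro AE_I2 impI allI)
    fix \<omega> n assume u: "\<forall>n i. \<bar>u i n \<omega>\<bar> \<le> G / sqrt \<epsilon>"
    have "\<bar>(x (Suc (Suc n)) \<omega> - x (Suc n) \<omega>) $ i\<bar> = \<eta> (Suc n) * \<bar>u i n \<omega>\<bar>" for i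
      using params(1)[of "Suc n"] by (simp add: u_def abs_div)
    then have "norm (x (Suc (Suc n)) \<omega> - x (Suc n) \<omega>) \<le> (\<Sum>i\<in>UNIV. \<eta> (Suc n) * \<bar>u i n \<omega>\<bar>)"
      using norm_le_l1_cart[of "x (Suc (Suc n)) \<omega> - x (Suc n) \<omega>"] by simp
    also have "\<dots> \<le> (\<Sum>i\<in>(UNIV :: 'd set). \<eta> (Suc n) * (G / sqrt \<epsilon>))"
      using u params(1)[of "Suc n"] by (intro sum_mono mult_left_mono) auto
    finally show "norm (x (Suc (Suc n)) \<omega> - x (Suc n) \<omega>) \<le> U * \<eta> (Suc n)"
      by (simp add: U_def mult_ac)
  qed
  have \<alpha>_pos: "0 < \<alpha> (Suc n)" for n
  proof -
    have "0 < C0' * \<alpha> (Suc n)"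
      using step_comparable(4)[of "Suc n"] params(1)[of "Suc n"] by linarith
    then show ?thesis using step_comparable(3) by (simp add: zero_less_mult_iff)
  qed

  \<comment> \<open>Reduction to single coordinates\<close>
  have coordinate: "momentum_coordinate M (\<lambda>n. history M x (Suc n)) (a i) (\<lambda>n \<omega>. g (Suc n) \<omega> $ i) (u i)
      (\<lambda>n \<omega>. m n \<omega> $ i) (h i) (\<lambda>n. \<alpha> (Suc n)) (\<lambda>n. \<beta> (Suc n)) (\<lambda>n. \<eta> (Suc n))
      (\<lambda>n. G\<^sup>2 / sqrt \<epsilon> * (1 - \<theta> (Suc n))) \<beta>_max G (L * U) (sqrt \<epsilon>) H C0 C0'" for i
  proof
    fix n
    show "subalgebra M (history M x (Suc n))" by (rule subalg)
    show "subalgebra (history M x (Suc (Suc n))) (history M x (Suc n))"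
      by (rule subalgebra_history_mono) simp
    show "a i n \<in> borel_measurable (history M x (Suc n))"
      unfolding a_def
      by (intro borel_measurable_vec_nth measurable_compose[OF measurable_history]) auto
    show "u i n \<in> borel_measurable (history M x (Suc (Suc n)))"
      unfolding u_def
      by (intro borel_measurable_divide borel_measurable_diff borel_measurable_vec_nth
        borel_measurable_const measurable_history) auto
    show "(\<lambda>\<omega>. g (Suc n) \<omega> $ i) \<in> borel_measurable M" by simp
    show "(\<lambda>\<omega>. m n \<omega> $ i) \<in> borel_measurable M" by simp
    show "h i n \<in> borel_measurable M" unfolding h_def by (rule h_meas)
    show "AE \<omega> in M. real_cond_exp M (history M x (Suc n)) (\<lambda>\<omega>. g (Suc n) \<omega> $ i) \<omega> = a i n \<omega>"
      by (rule a_unbiased)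
    show "AE \<omega> in M. \<bar>a i n \<omega>\<bar> \<le> G" by (rule a_bound)
    show "AE \<omega> in M. \<bar>g (Suc n) \<omega> $ i\<bar> \<le> G"
      using g_bounded(2)[of "Suc n", simplified]
      by eventually_elim (rule order_trans[OF component_le_norm_cart])
    show "AE \<omega> in M. \<bar>m n \<omega> $ i\<bar> \<le> G" using mv_bounds by eventually_elim simp
    show "AE \<omega> in M. sqrt \<epsilon> \<le> h i n \<omega>" using mv_bounds by eventually_elim (simp add: h_def)
    show "AE \<omega> in M. h i n \<omega> \<le> H" using mv_bounds by eventually_elim (simp add: h_def H_def)
    \<comment> \<open>The second moment moves by the fraction \<open>1 - \<theta> (Suc n)\<close> of
      a difference of two numbers between 0 and \<open>G\<^sup>2\<close>; the root adds the factor
      \<open>1 / sqrt \<epsilon>\<close>. The third condition on the step sizes makes this drift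
      summable against \<eta>.\<close>
    show "AE \<omega> in M. \<bar>h i (Suc n) \<omega> - h i n \<omega>\<bar> \<le> G\<^sup>2 / sqrt \<epsilon> * (1 - \<theta> (Suc n))"
      using mv_bounds g_bound AE_space
    proof eventually_elim
      case (elim \<omega>)
      have \<theta>: "0 \<le> 1 - \<theta> (Suc n)" using params(5)[of "Suc n"] by simp
      have "\<bar>g (Suc n) \<omega> $ i\<bar> \<le> G"
        using elim(2)[rule_format, of "Suc n"] component_le_norm_cart[of "g (Suc n) \<omega>" i] by simp
      then have "(g (Suc n) \<omega> $ i)\<^sup>2 \<le> G\<^sup>2"
        using power_mono[of "\<bar>g (Suc n) \<omega> $ i\<bar>" G 2] by simp
      then have "\<bar>(g (Suc n) \<omega> $ i)\<^sup>2 - v n \<omega> $ i\<bar> \<le> G\<^sup>2"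
        using elim(1)[rule_format, of n i] zero_le_power2[of "g (Suc n) \<omega> $ i"]
        unfolding abs_le_iff by linarith
      then have "(1 - \<theta> (Suc n)) * \<bar>(g (Suc n) \<omega> $ i)\<^sup>2 - v n \<omega> $ i\<bar> \<le> (1 - \<theta> (Suc n)) * G\<^sup>2"
        by (intro mult_left_mono \<theta>)
      moreover have "v (Suc n) \<omega> $ i - v n \<omega> $ i = (1 - \<theta> (Suc n)) * ((g (Suc n) \<omega> $ i)\<^sup>2 - v n \<omega> $ i)"
        by (subst v_step[OF elim(3)]) (simp_all add: algebra_simps)
      ultimately have "\<bar>v (Suc n) \<omega> $ i - v n \<omega> $ i\<bar> \<le> (1 - \<theta> (Suc n)) * G\<^sup>2"
        using \<theta> by (simp add: abs_mult)
      then have "\<bar>v (Suc n) \<omega> $ i - v n \<omega> $ i\<bar> / sqrt \<epsilon> \<le> (1 - \<theta> (Suc n)) * G\<^sup>2 / sqrt \<epsilon>"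
        using params(2) by (intro divide_right_mono) auto
      then show ?case
        using abs_sqrt_diff_le[of \<epsilon> "v (Suc n) \<omega> $ i + \<epsilon>" "v n \<omega> $ i + \<epsilon>"] params(2) elim(1)
        by (simp add: h_def mult_ac)
    qed
    show "AE \<omega> in M. \<bar>a i (Suc n) \<omega> - a i n \<omega>\<bar> \<le> L * U * \<eta> (Suc n)"
      using step_bound
    proof eventually_elim
      case (elim \<omega>)
      have "\<bar>a i (Suc n) \<omega> - a i n \<omega>\<bar> \<le> norm (grad_f (x (Suc (Suc n)) \<omega>) - grad_f (x (Suc n) \<omega>))"
        unfolding a_def vector_minus_component[symmetric] by (rule component_le_norm_cart)
      also have "\<dots> \<le> L * norm (x (Suc (Suc n)) \<omega> - x (Suc n) \<omega>)" by (rule L_smooth)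
      also have "\<dots> \<le> L * (U * \<eta> (Suc n))" using elim L_smooth by (intro mult_left_mono) auto
      finally show ?case by (simp add: mult_ac)
    qed
    show "0 \<le> \<alpha> (Suc n)" using \<alpha>_pos less_imp_le by blast
    show "\<alpha> (Suc (Suc n)) \<le> \<alpha> (Suc n)" by (rule step_comparable) auto
  next
    show "summable (\<lambda>n. \<eta> (Suc n) * (G\<^sup>2 / sqrt \<epsilon> * (1 - \<theta> (Suc n))))"
      using summable_mult[OF step_sizes(3), of "G\<^sup>2 / sqrt \<epsilon>"] by (simp add: mult_ac)
  qed (use params g_bounded(1) L_smooth(1) step_comparable step_sizes in
    \<open>auto simp: init m_step u_eq U_def\<close>)

  define c where "c = (1 - \<beta>_max) / (2 * H)"
  have c: "0 < c" using params(2,4) by (simp add: c_def H_def add_nonneg_pos)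
  have "\<forall>i. \<exists>C. \<forall>K. c * (\<Sum>n<K. \<eta> (Suc n) * expectation (\<lambda>\<omega>. (a i n \<omega>)\<^sup>2))
      \<le> (\<Sum>n<K. \<eta> (Suc n) * expectation (\<lambda>\<omega>. a i n \<omega> * u i n \<omega>)) + C"
    using momentum_coordinate.sum_expectation_square_le[OF coordinate] unfolding c_def by (rule allI)
  then obtain C where C: "c * (\<Sum>n<K. \<eta> (Suc n) * expectation (\<lambda>\<omega>. (a i n \<omega>)\<^sup>2))
      \<le> (\<Sum>n<K. \<eta> (Suc n) * expectation (\<lambda>\<omega>. a i n \<omega> * u i n \<omega>)) + C i" for i K
    by (auto dest!: choice)

  have bounded_a: "bounded_rv M (a i n)" and bounded_u: "bounded_rv M (u i n)" for i n
    using momentum_coordinate.bounded_a[OF coordinate] momentum_coordinate.bounded_u[OF coordinate] by blast+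

  \<comment> \<open>Descent of the objective\<close>
  \<comment> \<open>Monotonicity of \<alpha> bounds all step sizes, so a squared step size is at
    most \<open>\<eta>m\<close> times the step size.\<close>
  define \<eta>m where "\<eta>m = C0' * \<alpha> 1"
  have \<eta>m: "\<eta> (Suc n) \<le> \<eta>m" for n
  proof -
    have "\<eta> (Suc n) \<le> C0' * \<alpha> (Suc n)" using step_comparable(4)[of "Suc n"] by simp
    also have "\<dots> \<le> \<eta>m" unfolding \<eta>m_def using step_comparable by (intro mult_left_mono) auto
    finally show ?thesis .
  qed
  have \<eta>_pos: "0 < \<eta> (Suc n)" for n using params(1) by simp
  have U: "0 \<le> U" using g_bounded(1) params(2) by (simp add: U_def)
  \<comment> \<open>First-order part \<open>Gd * U\<close> plus the quadratic remainder, the latter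
    made linear in the step size by \<open>\<eta>m\<close>.\<close>
  define B where "B = Gd * U + L * U\<^sup>2 * \<eta>m"
  have B: "0 \<le> B"
    using g_bounded(1) U L_smooth(1) \<eta>m[of 0] \<eta>_pos[of 0] by (simp add: B_def Gd_def)

  have descent: "AE \<omega> in M. f (x (Suc (Suc n)) \<omega>)
      \<le> f (x (Suc n) \<omega>) - \<eta> (Suc n) * (\<Sum>i\<in>UNIV. a i n \<omega> * u i n \<omega>) + L * U\<^sup>2 * (\<eta> (Suc n))\<^sup>2"
    and f_step: "AE \<omega> in M. \<bar>f (x (Suc (Suc n)) \<omega>) - f (x (Suc n) \<omega>)\<bar> \<le> B * \<eta> (Suc n)" for n
  proof -
    let ?d = "\<lambda>\<omega>. x (Suc (Suc n)) \<omega> - x (Suc n) \<omega>"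
    have err: "AE \<omega> in M. \<bar>f (x (Suc (Suc n)) \<omega>) - f (x (Suc n) \<omega>) - grad_f (x (Suc n) \<omega>) \<bullet> ?d \<omega>\<bar>
        \<le> L * U\<^sup>2 * (\<eta> (Suc n))\<^sup>2"
      using step_bound
    proof eventually_elim
      case (elim \<omega>)
      have "(norm (?d \<omega>))\<^sup>2 \<le> (U * \<eta> (Suc n))\<^sup>2" using elim by (intro power_mono) auto
      then have "L * (norm (?d \<omega>))\<^sup>2 \<le> L * (U * \<eta> (Suc n))\<^sup>2"
        using L_smooth(1) by (intro mult_left_mono) auto
      then show ?case
        using smooth_first_order_error[OF f_gradient L_smooth(2), of "x (Suc (Suc n)) \<omega>" "x (Suc n) \<omega>"]
        by (simp add: power_mult_distrib mult_ac)
    qed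
    have inner: "grad_f (x (Suc n) \<omega>) \<bullet> ?d \<omega> = - \<eta> (Suc n) * (\<Sum>i\<in>UNIV. a i n \<omega> * u i n \<omega>)" for \<omega>
      unfolding inner_vec_def sum_distrib_left using \<eta>_pos[of n]
      by (intro sum.cong) (simp_all add: a_def u_def field_simps)
    show "AE \<omega> in M. f (x (Suc (Suc n)) \<omega>)
      \<le> f (x (Suc n) \<omega>) - \<eta> (Suc n) * (\<Sum>i\<in>UNIV. a i n \<omega> * u i n \<omega>) + L * U\<^sup>2 * (\<eta> (Suc n))\<^sup>2"
      using err unfolding inner by eventually_elim (simp add: abs_le_iff)
    show "AE \<omega> in M. \<bar>f (x (Suc (Suc n)) \<omega>) - f (x (Suc n) \<omega>)\<bar> \<le> B * \<eta> (Suc n)"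
      using err step_bound grad_bound[of n]
    proof eventually_elim
      case (elim \<omega>)
      have "\<bar>grad_f (x (Suc n) \<omega>) \<bullet> ?d \<omega>\<bar> \<le> norm (grad_f (x (Suc n) \<omega>)) * norm (?d \<omega>)"
        by (rule Cauchy_Schwarz_ineq2)
      also have "\<dots> \<le> Gd * (U * \<eta> (Suc n))" using elim by (intro mult_mono') auto
      finally have 1: "\<bar>grad_f (x (Suc n) \<omega>) \<bullet> ?d \<omega>\<bar> \<le> Gd * U * \<eta> (Suc n)" by (simp add: mult_ac)
      have "L * U\<^sup>2 * (\<eta> (Suc n))\<^sup>2 \<le> L * U\<^sup>2 * (\<eta>m * \<eta> (Suc n))"
        using \<eta>m[of n] \<eta>_pos[of n] L_smooth(1) unfolding power2_eq_square[of "\<eta> (Suc n)"]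
        by (intro mult_left_mono mult_right_mono) auto
      with elim(1) 1 show ?case unfolding B_def by (simp add: algebra_simps)
    qed
  qed

  \<comment> \<open>The start is deterministic and every increment is bounded, so each iterate has
    its own bound, possibly growing with \<open>n\<close>; this suffices for integrability.\<close>
  have bounded_f: "bounded_rv M (\<lambda>\<omega>. f (x (Suc n) \<omega>))" for n
  proof -
    have "\<exists>c. AE \<omega> in M. \<bar>f (x (Suc n) \<omega>)\<bar> \<le> c"
    proof (induction n)
      case 0
      have "AE \<omega> in M. \<bar>f (x (Suc 0) \<omega>)\<bar> \<le> \<bar>f x1\<bar>"
        using AE_space by eventually_elim (simp add: init[unfolded One_nat_def])
      then show ?case ..
    next
      case (Suc n)
      then obtain c where "AE \<omega> in M. \<bar>f (x (Suc n) \<omega>)\<bar> \<le> c" ..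
      then have "AE \<omega> in M. \<bar>f (x (Suc (Suc n)) \<omega>)\<bar> \<le> c + B * \<eta> (Suc n)"
        using f_step[of n] by eventually_elim linarith
      then show ?case ..
    qed
    moreover have "(\<lambda>\<omega>. f (x (Suc n) \<omega>)) \<in> borel_measurable M" by measurable
    ultimately show ?thesis unfolding bounded_rv_def by blast
  qed

  define \<Delta> where "\<Delta> n \<omega> = f (x (Suc n) \<omega>) - fstar" for n \<omega>
  have \<Delta>_nonneg: "0 \<le> \<Delta> n \<omega>" for n \<omega> using fstar_le by (simp add: \<Delta>_def)
  have bounded_\<Delta>: "bounded_rv M (\<Delta> n)" for n
    unfolding \<Delta>_def by (intro bounded_rv_intros bounded_f)
  note int = bounded_rv_integrable bounded_rv_intros bounded_\<Delta> bounded_a bounded_u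
  have E\<Delta>_nonneg: "0 \<le> expectation (\<Delta> n)" for n using \<Delta>_nonneg by simp
  have E\<Delta>_step: "expectation (\<Delta> (Suc n)) \<le> expectation (\<Delta> n) + B * \<eta> (Suc n)" for n
  proof -
    have "expectation (\<Delta> (Suc n)) \<le> expectation (\<lambda>\<omega>. \<Delta> n \<omega> + B * \<eta> (Suc n))"
    proof (rule integral_mono_AE)
      show "AE \<omega> in M. \<Delta> (Suc n) \<omega> \<le> \<Delta> n \<omega> + B * \<eta> (Suc n)"
        using f_step[of n] by eventually_elim (simp add: \<Delta>_def abs_le_iff)
    qed (intro int)+
    also have "\<dots> = expectation (\<Delta> n) + B * \<eta> (Suc n)"
      by (subst Bochner_Integration.integral_add) (auto intro!: int simp: prob_space)
    finally show ?thesis .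
  qed
  let ?au = "\<lambda>i n. expectation (\<lambda>\<omega>. a i n \<omega> * u i n \<omega>)"
  have E\<Delta>_descent: "\<eta> (Suc n) * (\<Sum>i\<in>UNIV. ?au i n)
      \<le> expectation (\<Delta> n) - expectation (\<Delta> (Suc n)) + L * U\<^sup>2 * (\<eta> (Suc n))\<^sup>2" for n
  proof -
    have "expectation (\<Delta> (Suc n)) \<le> expectation (\<lambda>\<omega>. \<Delta> n \<omega> -
        \<eta> (Suc n) * (\<Sum>i\<in>UNIV. a i n \<omega> * u i n \<omega>) + L * U\<^sup>2 * (\<eta> (Suc n))\<^sup>2)"
    proof (rule integral_mono_AE)
      show "AE \<omega> in M. \<Delta> (Suc n) \<omega> \<le> \<Delta> n \<omega> -
        \<eta> (Suc n) * (\<Sum>i\<in>UNIV. a i n \<omega> * u i n \<omega>) + L * U\<^sup>2 * (\<eta> (Suc n))\<^sup>2"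
        using descent[of n] by eventually_elim (simp add: \<Delta>_def)
    qed (intro int)+
    also have "\<dots> = expectation (\<lambda>\<omega>. \<Delta> n \<omega> - \<eta> (Suc n) * (\<Sum>i\<in>UNIV. a i n \<omega> * u i n \<omega>))
        + L * U\<^sup>2 * (\<eta> (Suc n))\<^sup>2"
      by (subst Bochner_Integration.integral_add) (auto intro!: int simp: prob_space)
    also have "expectation (\<lambda>\<omega>. \<Delta> n \<omega> - \<eta> (Suc n) * (\<Sum>i\<in>UNIV. a i n \<omega> * u i n \<omega>))
        = expectation (\<Delta> n) - expectation (\<lambda>\<omega>. \<eta> (Suc n) * (\<Sum>i\<in>UNIV. a i n \<omega> * u i n \<omega>))"
      by (rule Bochner_Integration.integral_diff) (intro int)+
    also have "expectation (\<lambda>\<omega>. \<eta> (Suc n) * (\<Sum>i\<in>UNIV. a i n \<omega> * u i n \<omega>)) = \<eta> (Suc n) * (\<Sum>i\<in>UNIV. ?au i n)"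
      by (subst integral_mult_right_zero, subst Bochner_Integration.integral_sum) (auto intro!: int)
    finally show ?thesis by simp
  qed
  have E\<Delta>_PL: "2 * \<mu> * expectation (\<Delta> n) \<le> (\<Sum>i\<in>UNIV. expectation (\<lambda>\<omega>. (a i n \<omega>)\<^sup>2))" for n
  proof -
    have "2 * \<mu> * expectation (\<Delta> n) = expectation (\<lambda>\<omega>. 2 * \<mu> * \<Delta> n \<omega>)" by simp
    also have "\<dots> \<le> expectation (\<lambda>\<omega>. \<Sum>i\<in>UNIV. (a i n \<omega>)\<^sup>2)"
    proof (rule integral_mono)
      show "2 * \<mu> * \<Delta> n \<omega> \<le> (\<Sum>i\<in>UNIV. (a i n \<omega>)\<^sup>2)" for \<omega>
        using PL(2)[of "x (Suc n) \<omega>"] unfolding power2_norm_eq_inner inner_vec_def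
        by (simp add: \<Delta>_def a_def power2_eq_square)
    qed (intro int)+
    also have "\<dots> = (\<Sum>i\<in>UNIV. expectation (\<lambda>\<omega>. (a i n \<omega>)\<^sup>2))"
      by (rule Bochner_Integration.integral_sum) (intro int)
    finally show ?thesis .
  qed

  \<comment> \<open>Weighted sum of the expected gaps\<close>
  \<comment> \<open>Initial gap, total quadratic error and the constants of all coordinates: what
    remains after the PL inequality, the coordinate estimates and the telescoped descent are chained
    and the last gap, being nonnegative, is dropped.\<close>
  define S where "S = expectation (\<Delta> 0) + L * U\<^sup>2 * (\<Sum>n. (\<eta> (Suc n))\<^sup>2) + (\<Sum>i\<in>UNIV. C i)"
  have bounded_sum: "(\<Sum>n<K. \<eta> (Suc n) * expectation (\<Delta> n)) \<le> S / (2 * \<mu> * c)" for K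
  proof -
    have "c * (2 * \<mu> * (\<Sum>n<K. \<eta> (Suc n) * expectation (\<Delta> n)))
        = c * (\<Sum>n<K. \<eta> (Suc n) * (2 * \<mu> * expectation (\<Delta> n)))"
      by (simp add: sum_distrib_left mult_ac)
    also have "\<dots> \<le> c * (\<Sum>n<K. \<eta> (Suc n) * (\<Sum>i\<in>UNIV. expectation (\<lambda>\<omega>. (a i n \<omega>)\<^sup>2)))"
      using c \<eta>_pos by (intro mult_left_mono sum_mono E\<Delta>_PL) (auto simp: less_imp_le)
    also have "\<dots> = (\<Sum>i\<in>UNIV. c * (\<Sum>n<K. \<eta> (Suc n) * expectation (\<lambda>\<omega>. (a i n \<omega>)\<^sup>2)))"
      unfolding sum_distrib_left by (rule sum.swap)
    also have "\<dots> \<le> (\<Sum>i\<in>UNIV. (\<Sum>n<K. \<eta> (Suc n) * ?au i n) + C i)"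
      by (intro sum_mono C)
    also have "\<dots> = (\<Sum>n<K. \<eta> (Suc n) * (\<Sum>i\<in>UNIV. ?au i n)) + (\<Sum>i\<in>UNIV. C i)"
      unfolding sum_distrib_left sum.distrib by (subst sum.swap) (rule refl)
    also have "(\<Sum>n<K. \<eta> (Suc n) * (\<Sum>i\<in>UNIV. ?au i n))
        \<le> (\<Sum>n<K. expectation (\<Delta> n) - expectation (\<Delta> (Suc n)) + L * U\<^sup>2 * (\<eta> (Suc n))\<^sup>2)"
      by (intro sum_mono E\<Delta>_descent)
    also have "\<dots> = expectation (\<Delta> 0) - expectation (\<Delta> K) + L * U\<^sup>2 * (\<Sum>n<K. (\<eta> (Suc n))\<^sup>2)"
      using sum_lessThan_telescope'[of "\<lambda>n. expectation (\<Delta> n)" K]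
      by (simp add: sum.distrib sum_distrib_left)
    also have "L * U\<^sup>2 * (\<Sum>n<K. (\<eta> (Suc n))\<^sup>2) \<le> L * U\<^sup>2 * (\<Sum>n. (\<eta> (Suc n))\<^sup>2)"
      using L_smooth(1) step_sizes(2) by (intro mult_left_mono sum_le_suminf) auto
    finally have "c * (2 * \<mu> * (\<Sum>n<K. \<eta> (Suc n) * expectation (\<Delta> n))) \<le> S"
      using E\<Delta>_nonneg[of K] unfolding S_def by simp
    then show ?thesis using c PL(1) by (simp add: field_simps)
  qed
  have summable_E\<Delta>: "summable (\<lambda>n. \<eta> (Suc n) * expectation (\<Delta> n))"
    using E\<Delta>_nonneg \<eta>_pos bounded_sum by (intro summableI_nonneg_bounded) (auto simp: less_imp_le)

  \<comment> \<open>Passage to the limit, pathwise and in mean\<close>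
  have not_summable: "\<not> summable (\<lambda>n. \<eta> (Suc n))"
  proof
    assume "summable (\<lambda>n. \<eta> (Suc n))"
    then have "(\<lambda>n. \<Sum>k<n. \<eta> (Suc k)) \<longlonglongrightarrow> (\<Sum>n. \<eta> (Suc n))" by (rule summable_LIMSEQ)
    moreover have "(\<Sum>k<n. \<eta> (Suc k)) = (\<Sum>k=1..n. \<eta> k)" for n
      by (rule sum.reindex_bij_witness[of _ "\<lambda>k. k - 1" Suc]) auto
    ultimately show False
      using step_sizes(1) not_tendsto_and_filterlim_at_infinity[OF sequentially_bot]
        filterlim_at_top_imp_at_infinity by auto
  qed
  note tendsto_zero = tendsto_zero_of_weighted_summable[OF less_imp_le[OF \<eta>_pos] not_summable step_sizes(2)]

  have "AE \<omega> in M. summable (\<lambda>n. \<eta> (Suc n) * \<Delta> n \<omega>)"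
  proof (rule AE_summable_of_summable_integral)
    show "integrable M (\<lambda>\<omega>. \<eta> (Suc n) * \<Delta> n \<omega>)" for n by (intro int)
    show "0 \<le> \<eta> (Suc n) * \<Delta> n \<omega>" for n \<omega> using \<eta>_pos[of n] \<Delta>_nonneg by simp
    show "summable (\<lambda>n. expectation (\<lambda>\<omega>. \<eta> (Suc n) * \<Delta> n \<omega>))" using summable_E\<Delta> by simp
  qed
  moreover have "AE \<omega> in M. \<forall>n. \<bar>f (x (Suc (Suc n)) \<omega>) - f (x (Suc n) \<omega>)\<bar> \<le> B * \<eta> (Suc n)"
    using f_step by (simp add: AE_all_countable)
  ultimately have almost_sure: "AE \<omega> in M. (\<lambda>k. f (x k \<omega>)) \<longlonglongrightarrow> fstar"
  proof eventually_elim
    case (elim \<omega>)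
    have "\<Delta> (Suc n) \<omega> \<le> \<Delta> n \<omega> + B * \<eta> (Suc n)" for n
      using elim(2)[rule_format, of n] by (simp add: \<Delta>_def abs_le_iff)
    then have "(\<lambda>n. \<Delta> n \<omega>) \<longlonglongrightarrow> 0"
      by (intro tendsto_zero[OF \<Delta>_nonneg B _ elim(1)])
    then have "(\<lambda>n. f (x (Suc n) \<omega>)) \<longlonglongrightarrow> fstar"
      unfolding \<Delta>_def using LIM_zero_iff by blast
    then show ?case by (rule LIMSEQ_imp_Suc)
  qed
  have integrable_f: "integrable M (\<lambda>\<omega>. f (x (Suc n) \<omega>))" for n
    by (rule bounded_rv_integrable[OF bounded_f])
  have "(\<lambda>n. expectation (\<Delta> n)) \<longlonglongrightarrow> 0"
    by (rule tendsto_zero[OF E\<Delta>_nonneg B E\<Delta>_step summable_E\<Delta>])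
  moreover have "expectation (\<Delta> n) = expectation (\<lambda>\<omega>. f (x (Suc n) \<omega>)) - fstar" for n
    unfolding \<Delta>_def using integrable_f by (simp add: prob_space)
  ultimately have "(\<lambda>n. expectation (\<lambda>\<omega>. f (x (Suc n) \<omega>))) \<longlonglongrightarrow> fstar"
    by (simp add: LIM_zero_iff)
  then have mean: "(\<lambda>k. expectation (\<lambda>\<omega>. f (x k \<omega>))) \<longlonglongrightarrow> fstar"
    by (rule LIMSEQ_imp_Suc)
  have "integrable M (\<lambda>\<omega>. f (x k \<omega>))" if "k \<ge> 1" for k
    using integrable_f[of "k - 1"] that by simp
  with almost_sure mean show ?thesis by blast
qed

end
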